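(* Let $\mathcal{A}$ be an infinite (countable) structure with universe $\omega$ and let $n\in\omega$. (a) $\mathcal{A}$ has a generically computable copy if and only if $\mathcal{A}$ has an (infinite) substructure that is isomorphic to a computable structure. (b) $\mathcal{A}$ has a $\Sigma_n$-generically c.e. copy if and only if $\mathcal{A}$ has an (infinite) $\Sigma_n$ elementary substructure that is isomorphic to a c.e. structure. (c) If $\mathcal{A}$ is a linear ordering, then $\mathcal{A}$ has a $\Sigma_n$-generically c.e. copy if and only if $\mathcal{A}$ has an (infinite) $\Sigma_n$ elementary substructure that is isomorphic to a computable structure.
   Context: Structures are countable with universe $\omega$ unless they arise as substructures, whose universe is a subset of $\omega$ closed under the functions. A copy of a structure is a structure with universe $\omega$ isomorphic to it. A computable structure has universe $\omega$ and each of its functions and relations is computable. A c.e. structure has universe an (infinite) c.e. set, each of its relations is c.e., and each of its functions has c.e. graph. A set $D\subseteq\omega$ is dense if $\lim_{n\to\infty}|D\cap\{0,\dots,n\}|/(n+1)=1$. $\mathcal{A}$ is generically computable if it has a substructure whose universe $D$ is a dense c.e. set and such that for every $k$-ary function $f$ and $k$-ary relation $R$ of $\mathcal{A}$, $f\restriction D^k$ and $\chi_R\restriction D^k$ are restrictions to $D^k$ of partial computable functions. Formulas are infinitary formulas of $\mathcal{L}_{\omega_1,\omega}$: $\Sigma_0=\Pi_0$ are the finitary quantifier-free formulas, and for $n\ge 1$ a $\Sigma_n$ formula is a countable disjunction of formulas $\exists \bar x\,\psi$ with $\psi\in\Pi_m$, $m<n$ (dually for $\Pi_n$). A substructure $\mathcal{B}$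 of $\mathcal{A}$ is a $\Sigma_n$ elementary substructure if for every $\Sigma_n$ formula $\phi$ and every tuple $\bar b$ from $\mathcal{B}$, $\mathcal{B}\models\phi(\bar b)\iff\mathcal{A}\models\phi(\bar b)$. $\mathcal{A}$ is $\Sigma_n$-generically c.e. if there is a dense c.e. set $D$ such that the substructure of $\mathcal{A}$ with universe $D$ is a c.e. substructure (c.e. universe, c.e. relations on it, functions with c.e. graph) and a $\Sigma_n$ elementary substructure of $\mathcal{A}$. *)

theory Defs
  imports Complex_Main "HOL-Library.Countable_Set_Type"
begin

section \<open>Partial computable functions and c.e. relations\<close>

text \<open>
  Codes for partial recursive functions do not carry an arity: a code denotes, for every \<open>k\<close>,
  a partial function on the lists of length \<open>k\<close> (undefined if the code is ill-formed at that
  arity). \<open>PrimRec\<close> recurses on the first argument; \<open>Mu\<close> minimises over the first argument.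
\<close>

datatype recf = Zero | Succ | Proj nat | Comp recf "recf list" | PrimRec recf recf | Mu recf

inductive evaluates :: "recf \<Rightarrow> nat list \<Rightarrow> nat \<Rightarrow> bool" where
  Zero: "evaluates Zero xs 0"
| Succ: "evaluates Succ [x] (Suc x)"
| Proj: "i < length xs \<Longrightarrow> evaluates (Proj i) xs (xs ! i)"
| Comp: "list_all2 (\<lambda>g y. evaluates g xs y) gs ys \<Longrightarrow> evaluates f ys z
    \<Longrightarrow> evaluates (Comp f gs) xs z"
| PrimRec_0: "evaluates f xs y \<Longrightarrow> evaluates (PrimRec f g) (0 # xs) y"
| PrimRec_Suc: "evaluates (PrimRec f g) (m # xs) r \<Longrightarrow> evaluates g (m # r # xs) y
    \<Longrightarrow> evaluates (PrimRec f g) (Suc m # xs) y"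
| Mu: "evaluates f (m # xs) 0 \<Longrightarrow> (\<forall>i<m. \<exists>y. evaluates f (i # xs) (Suc y))
    \<Longrightarrow> evaluates (Mu f) xs m"

definition partial_computable :: "nat \<Rightarrow> (nat list \<Rightarrow> nat option) \<Rightarrow> bool" where
  "partial_computable k p \<longleftrightarrow>
     (\<exists>c. \<forall>xs. length xs = k \<longrightarrow> (\<forall>y. p xs = Some y \<longleftrightarrow> evaluates c xs y))"

definition computable_fun :: "nat \<Rightarrow> (nat list \<Rightarrow> nat) \<Rightarrow> bool" where
  "computable_fun k f \<longleftrightarrow> partial_computable k (\<lambda>xs. Some (f xs))"

definition char_fun :: "nat list set \<Rightarrow> nat list \<Rightarrow> nat" where
  "char_fun R xs = (if xs \<in> R then 1 else 0)"

definition computable_rel :: "nat \<Rightarrow> nat list set \<Rightarrow> bool" where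
  "computable_rel k R \<longleftrightarrow> computable_fun k (char_fun R)"

definition ce_rel :: "nat \<Rightarrow> nat list set \<Rightarrow> bool" where
  "ce_rel k R \<longleftrightarrow>
     (\<exists>p. partial_computable k p \<and> (\<forall>xs. length xs = k \<longrightarrow> (xs \<in> R \<longleftrightarrow> p xs \<noteq> None)))"

definition ce_set :: "nat set \<Rightarrow> bool" where
  "ce_set D \<longleftrightarrow> ce_rel 1 {[x] | x. x \<in> D}"

definition dense :: "nat set \<Rightarrow> bool" where
  "dense D \<longleftrightarrow> (\<lambda>n. real (card (D \<inter> {0..n})) / real (n + 1)) \<longlonglongrightarrow> 1"


section \<open>Structures with universe a set of natural numbers\<close>

text \<open>
  The symbols of a language are sets inside the types \<open>'f\<close> and \<open>'r\<close>, so that a language may have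
  no function symbols or no relation symbols; constants are function symbols of arity 0.
\<close>

record ('f, 'r) language =
  fsyms :: "'f set"
  rsyms :: "'r set"
  farity :: "'f \<Rightarrow> nat"
  rarity :: "'r \<Rightarrow> nat"

text \<open>
  \<open>func\<close> and \<open>rel\<close> are meaningful only for symbols of the language and for tuples over the universe
  of the right length; values elsewhere are ignored by all notions below.
\<close>

record ('f, 'r) struct =
  universe :: "nat set"
  func :: "'f \<Rightarrow> nat list \<Rightarrow> nat"
  rel :: "'r \<Rightarrow> nat list set"

definition tuples :: "nat \<Rightarrow> nat set \<Rightarrow> nat list set" where
  "tuples k D = {xs. length xs = k \<and> set xs \<subseteq> D}"

definition is_struct :: "('f, 'r) language \<Rightarrow> ('f, 'r) struct \<Rightarrow> bool" where
  "is_struct L M \<longleftrightarrow> universe M \<noteq> {} \<and>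
     (\<forall>f\<in>fsyms L. \<forall>xs\<in>tuples (farity L f) (universe M). func M f xs \<in> universe M)"

definition isomorphic ::
  "('f, 'r) language \<Rightarrow> ('f, 'r) struct \<Rightarrow> ('f, 'r) struct \<Rightarrow> bool" where
  "isomorphic L M N \<longleftrightarrow> (\<exists>h. bij_betw h (universe M) (universe N) \<and>
     (\<forall>f\<in>fsyms L. \<forall>xs\<in>tuples (farity L f) (universe M).
        h (func M f xs) = func N f (map h xs)) \<and>
     (\<forall>r\<in>rsyms L. \<forall>xs\<in>tuples (rarity L r) (universe M).
        xs \<in> rel M r \<longleftrightarrow> map h xs \<in> rel N r))"

definition copy_of ::
  "('f, 'r) language \<Rightarrow> ('f, 'r) struct \<Rightarrow> ('f, 'r) struct \<Rightarrow> bool" where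
  "copy_of L M A \<longleftrightarrow> is_struct L M \<and> universe M = UNIV \<and> isomorphic L M A"

definition substructure ::
  "('f, 'r) language \<Rightarrow> ('f, 'r) struct \<Rightarrow> ('f, 'r) struct \<Rightarrow> bool" where
  "substructure L B A \<longleftrightarrow> is_struct L B \<and> universe B \<subseteq> universe A \<and>
     (\<forall>f\<in>fsyms L. \<forall>xs\<in>tuples (farity L f) (universe B). func B f xs = func A f xs) \<and>
     (\<forall>r\<in>rsyms L. \<forall>xs\<in>tuples (rarity L r) (universe B). xs \<in> rel B r \<longleftrightarrow> xs \<in> rel A r)"

definition computable_struct :: "('f, 'r) language \<Rightarrow> ('f, 'r) struct \<Rightarrow> bool" where
  "computable_struct L M \<longleftrightarrow> is_struct L M \<and> universe M = UNIV \<and>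
     (\<forall>f\<in>fsyms L. computable_fun (farity L f) (func M f)) \<and>
     (\<forall>r\<in>rsyms L. computable_rel (rarity L r) (rel M r))"

definition ce_struct :: "('f, 'r) language \<Rightarrow> ('f, 'r) struct \<Rightarrow> bool" where
  "ce_struct L M \<longleftrightarrow> is_struct L M \<and> infinite (universe M) \<and> ce_set (universe M) \<and>
     (\<forall>f\<in>fsyms L. ce_rel (Suc (farity L f))
        {xs @ [func M f xs] | xs. xs \<in> tuples (farity L f) (universe M)}) \<and>
     (\<forall>r\<in>rsyms L. ce_rel (rarity L r) (rel M r \<inter> tuples (rarity L r) (universe M)))"

definition generically_computable :: "('f, 'r) language \<Rightarrow> ('f, 'r) struct \<Rightarrow> bool" where
  "generically_computable L A \<longleftrightarrow>
     (\<exists>B. substructure L B A \<and> dense (universe B) \<and> ce_set (universe B) \<and>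
       (\<forall>f\<in>fsyms L. \<exists>p. partial_computable (farity L f) p \<and>
          (\<forall>xs\<in>tuples (farity L f) (universe B). p xs = Some (func A f xs))) \<and>
       (\<forall>r\<in>rsyms L. \<exists>p. partial_computable (rarity L r) p \<and>
          (\<forall>xs\<in>tuples (rarity L r) (universe B). p xs = Some (char_fun (rel A r) xs))))"


section \<open>Infinitary formulas\<close>

datatype 'f trm = Var nat | App 'f "'f trm list"

datatype ('f, 'r) fm =
    Eq "'f trm" "'f trm"
  | Rel 'r "'f trm list"
  | Neg "('f, 'r) fm"
  | Conj "('f, 'r) fm cset"
  | Disj "('f, 'r) fm cset"
  | Ex nat "('f, 'r) fm"
  | All nat "('f, 'r) fm"

primrec tvars :: "'f trm \<Rightarrow> nat set" where
  "tvars (Var x) = {x}"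
| "tvars (App f ts) = \<Union> (set (map tvars ts))"

primrec fvars :: "('f, 'r) fm \<Rightarrow> nat set" where
  "fvars (Eq s t) = tvars s \<union> tvars t"
| "fvars (Rel r ts) = \<Union> (set (map tvars ts))"
| "fvars (Neg \<phi>) = fvars \<phi>"
| "fvars (Conj F) = \<Union> (rcset (cimage fvars F))"
| "fvars (Disj F) = \<Union> (rcset (cimage fvars F))"
| "fvars (Ex x \<phi>) = fvars \<phi> - {x}"
| "fvars (All x \<phi>) = fvars \<phi> - {x}"

primrec teval :: "('f, 'r) struct \<Rightarrow> (nat \<Rightarrow> nat) \<Rightarrow> 'f trm \<Rightarrow> nat" where
  "teval M e (Var x) = e x"
| "teval M e (App f ts) = func M f (map (teval M e) ts)"

primrec sat :: "('f, 'r) struct \<Rightarrow> ('f, 'r) fm \<Rightarrow> (nat \<Rightarrow> nat) \<Rightarrow> bool" where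
  "sat M (Eq s t) = (\<lambda>e. teval M e s = teval M e t)"
| "sat M (Rel r ts) = (\<lambda>e. map (teval M e) ts \<in> rel M r)"
| "sat M (Neg \<phi>) = (\<lambda>e. \<not> sat M \<phi> e)"
| "sat M (Conj F) = (\<lambda>e. \<forall>P\<in>rcset (cimage (sat M) F). P e)"
| "sat M (Disj F) = (\<lambda>e. \<exists>P\<in>rcset (cimage (sat M) F). P e)"
| "sat M (Ex x \<phi>) = (\<lambda>e. \<exists>a\<in>universe M. sat M \<phi> (e(x := a)))"
| "sat M (All x \<phi>) = (\<lambda>e. \<forall>a\<in>universe M. sat M \<phi> (e(x := a)))"

primrec wf_trm :: "('f, 'r) language \<Rightarrow> 'f trm \<Rightarrow> bool" where
  "wf_trm L (Var x) = True"
| "wf_trm L (App f ts) = (f \<in> fsyms L \<and> length ts = farity L f \<and> list_all id (map (wf_trm L) ts))"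

inductive qf_fm :: "('f, 'r) language \<Rightarrow> ('f, 'r) fm \<Rightarrow> bool" for L where
  "wf_trm L s \<Longrightarrow> wf_trm L t \<Longrightarrow> qf_fm L (Eq s t)"
| "r \<in> rsyms L \<Longrightarrow> length ts = rarity L r \<Longrightarrow> \<forall>t\<in>set ts. wf_trm L t \<Longrightarrow> qf_fm L (Rel r ts)"
| "qf_fm L \<phi> \<Longrightarrow> qf_fm L (Neg \<phi>)"
| "finite (rcset F) \<Longrightarrow> \<forall>\<phi>\<in>rcset F. qf_fm L \<phi> \<Longrightarrow> qf_fm L (Conj F)"
| "finite (rcset F) \<Longrightarrow> \<forall>\<phi>\<in>rcset F. qf_fm L \<phi> \<Longrightarrow> qf_fm L (Disj F)"

text \<open>
  The lists \<open>xs\<close> are the tuples of quantified variables; they may be empty, and the length and the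
  level \<open>m\<close> may vary with the member of the disjunction or conjunction.
\<close>

inductive Sigma_fm :: "('f, 'r) language \<Rightarrow> nat \<Rightarrow> ('f, 'r) fm \<Rightarrow> bool"
  and Pi_fm :: "('f, 'r) language \<Rightarrow> nat \<Rightarrow> ('f, 'r) fm \<Rightarrow> bool" for L where
  "qf_fm L \<phi> \<Longrightarrow> Sigma_fm L 0 \<phi>"
| "qf_fm L \<phi> \<Longrightarrow> Pi_fm L 0 \<phi>"
| "n \<ge> 1 \<Longrightarrow> \<forall>\<phi>\<in>rcset F. \<exists>xs \<psi> m. \<phi> = foldr Ex xs \<psi> \<and> m < n \<and> Pi_fm L m \<psi>
    \<Longrightarrow> Sigma_fm L n (Disj F)"
| "n \<ge> 1 \<Longrightarrow> \<forall>\<phi>\<in>rcset F. \<exists>xs \<psi> m. \<phi> = foldr All xs \<psi> \<and> m < n \<and> Sigma_fm L m \<psi>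
    \<Longrightarrow> Pi_fm L n (Conj F)"

text \<open>
  A formula is evaluated at a finite tuple of parameters, so only formulas with finitely many free
  variables count; the tuple \<open>b\<close> from \<open>B\<close> is given as an assignment into the universe of \<open>B\<close>.
\<close>

definition Sigma_elementary_substructure ::
  "nat \<Rightarrow> ('f, 'r) language \<Rightarrow> ('f, 'r) struct \<Rightarrow> ('f, 'r) struct \<Rightarrow> bool" where
  "Sigma_elementary_substructure n L B A \<longleftrightarrow> substructure L B A \<and>
     (\<forall>\<phi> b. Sigma_fm L n \<phi> \<and> finite (fvars \<phi>) \<and> range b \<subseteq> universe B
        \<longrightarrow> (sat B \<phi> b \<longleftrightarrow> sat A \<phi> b))"

definition Sigma_generically_ce ::
  "nat \<Rightarrow> ('f, 'r) language \<Rightarrow> ('f, 'r) struct \<Rightarrow> bool" where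
  "Sigma_generically_ce n L A \<longleftrightarrow>
     (\<exists>B. dense (universe B) \<and> ce_set (universe B) \<and> substructure L B A \<and> ce_struct L B \<and>
       Sigma_elementary_substructure n L B A)"


section \<open>Linear orderings\<close>

text \<open>
  The language has a single binary relation symbol, interpreted as either a strict or a reflexive
  linear order; both conventions for presenting a linear ordering are covered.
\<close>

definition linear_ordering :: "('f, 'r) language \<Rightarrow> ('f, 'r) struct \<Rightarrow> bool" where
  "linear_ordering L A \<longleftrightarrow> is_struct L A \<and> fsyms L = {} \<and>
     (\<exists>r. rsyms L = {r} \<and> rarity L r = 2 \<and>
       (let le = (\<lambda>x y. [x, y] \<in> rel A r) in
         transp_on (universe A) le \<and> totalp_on (universe A) le \<and>
         (irreflp_on (universe A) le \<or> reflp_on (universe A) le \<and> antisymp_on (universe A) le)))"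

end

theory Submission
  imports Defs "HOL-Library.Discrete_Functions"
begin

text \<open>
  All three parts rest on one observation: an isomorphic copy may be chosen by an arbitrary permutation
  of the natural numbers, and density concerns only the place that a substructure occupies, not the
  substructure itself.

  From left to right, a dense set \<open>D\<close> is infinite, and an infinite c.e. set has a computable enumeration
  without repetition (\<open>ce_set_enumeration\<close>), whose inverse is partial computable with domain \<open>D\<close>
  (\<open>partial_computable_inverse\<close>). Renaming along it makes a structure on \<open>D\<close>, computable there, into a
  computable structure on all natural numbers (\<open>generically_computable_substructure\<close>); for a c.e.
  structure on \<open>D\<close> no renaming is needed. The isomorphism from the copy to \<open>A\<close> maps \<open>D\<close> onto a
  substructure of \<open>A\<close>, and since it preserves the truth of infinitary formulas (\<open>sat_Sigma_iso\<close>), it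
  also preserves elementarity (\<open>Sigma_elementary_substructure_image\<close>).

  From right to left, let \<open>B\<close> be an infinite substructure of \<open>A\<close> isomorphic to an effective structure
  \<open>C\<close>, which may be assumed to have all natural numbers as its elements (\<open>ce_struct_on_UNIV\<close>). There is
  a dense c.e. set \<open>D\<close> whose complement has as many elements as the complement of \<open>B\<close>
  (\<open>dense_ce_set_with_complement\<close>). Hence some permutation maps \<open>B\<close> onto \<open>D\<close> in such a way that the
  composition with the isomorphism from \<open>C\<close> to \<open>B\<close> is a computable enumeration of \<open>D\<close>
  (\<open>move_to_dense_set\<close>). In the copy of \<open>A\<close> obtained by this permutation, the substructure on \<open>D\<close> is
  effectively isomorphic to \<open>C\<close> (\<open>copy_with_dense_substructure\<close>).

  For linear orderings, a c.e. structure on all natural numbers is already computable, because the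
  complement of the order relation is its converse up to the diagonal
  (\<open>ce_linear_ordering_computable\<close>).

  What is used of computability theory are closure properties of computable functions and the fact that
  a c.e. relation is approximated by a computable sequence of stages (\<open>ce_relE\<close>). The latter is obtained
  by induction on the code of a partial function from approximations with bounded searches, without a
  universal function or a coding of computations.
\<close>

section \<open>Partial recursive functions\<close>

lemma evaluates_Comp_iff:
  "evaluates (Comp f gs) xs z \<longleftrightarrow>
     (\<exists>ys. list_all2 (\<lambda>g y. evaluates g xs y) gs ys \<and> evaluates f ys z)"
  by (auto elim: evaluates.cases intro: evaluates.Comp)

lemma evaluates_Mu_iff:
  "evaluates (Mu f) xs m \<longleftrightarrow>
     evaluates f (m # xs) 0 \<and> (\<forall>i<m. \<exists>y. evaluates f (i # xs) (Suc y))"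
  by (auto elim: evaluates.cases intro: evaluates.Mu)

lemma evaluates_PrimRec_0_iff:
  "evaluates (PrimRec f g) (0 # xs) y \<longleftrightarrow> evaluates f xs y"
  by (auto elim: evaluates.cases intro: evaluates.PrimRec_0)

lemma evaluates_PrimRec_Suc_iff:
  "evaluates (PrimRec f g) (Suc m # xs) y \<longleftrightarrow>
     (\<exists>r. evaluates (PrimRec f g) (m # xs) r \<and> evaluates g (m # r # xs) y)"
  by (auto elim: evaluates.cases intro: evaluates.PrimRec_Suc)

lemma evaluates_Zero_iff: "evaluates Zero xs y \<longleftrightarrow> y = 0"
  by (auto elim: evaluates.cases intro: evaluates.Zero)

lemma evaluates_Succ_iff: "evaluates Succ xs y \<longleftrightarrow> (\<exists>x. xs = [x] \<and> y = Suc x)"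
  by (auto elim: evaluates.cases intro: evaluates.Succ)

lemma evaluates_Proj_iff: "evaluates (Proj i) xs y \<longleftrightarrow> i < length xs \<and> y = xs ! i"
  by (auto elim: evaluates.cases intro: evaluates.Proj)

lemma evaluates_PrimRec_Nil: "\<not> evaluates (PrimRec f g) [] y"
  by (auto elim: evaluates.cases)

lemmas evaluates_iffs =
  evaluates_Comp_iff evaluates_Mu_iff evaluates_PrimRec_0_iff evaluates_PrimRec_Suc_iff
  evaluates_Zero_iff evaluates_Succ_iff evaluates_Proj_iff evaluates_PrimRec_Nil

lemma evaluates_functional: "evaluates c xs y \<Longrightarrow> evaluates c xs z \<Longrightarrow> y = z"
proof (induction arbitrary: z rule: evaluates.induct)
  case (Comp xs gs ys f z')
  from Comp.prems obtain ys' where ys': "list_all2 (\<lambda>g y. evaluates g xs y) gs ys'" "evaluates f ys' z"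
    by (auto simp: evaluates_Comp_iff)
  have "ys = ys'"
    using Comp.IH(1) ys'(1) by (auto simp: list_all2_conv_all_nth intro!: nth_equalityI)
  with Comp.IH ys'(2) show ?case by blast
next
  case (PrimRec_Suc f g m xs r y)
  then show ?case by (metis evaluates_PrimRec_Suc_iff)
next
  case (Mu f m xs)
  have "\<not> z < m" "\<not> m < z"
    using Mu by (fastforce simp: evaluates_Mu_iff)+
  then show ?case by simp
qed (auto simp: evaluates_iffs)

lemma partial_computable_cong:
  assumes "partial_computable k p" "\<And>xs. length xs = k \<Longrightarrow> p xs = q xs"
  shows "partial_computable k q"
  using assms unfolding partial_computable_def by metis

lemma computable_fun_cong:
  assumes "computable_fun k f" "\<And>xs. length xs = k \<Longrightarrow> f xs = g xs"
  shows "computable_fun k g"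
  using assms partial_computable_cong unfolding computable_fun_def by (metis (no_types, lifting))

text \<open>A total function is computable as soon as some code outputs its values: no other output is
  possible, since evaluation is functional.\<close>

lemma computable_funI:
  assumes "\<And>xs. length xs = k \<Longrightarrow> evaluates c xs (f xs)"
  shows "computable_fun k f"
  using assms evaluates_functional unfolding computable_fun_def partial_computable_def
  by (metis option.inject)

lemma computable_funE:
  assumes "computable_fun k f"
  obtains c where "\<And>xs. length xs = k \<Longrightarrow> evaluates c xs (f xs)"
  using assms unfolding computable_fun_def partial_computable_def by blast

lemma partial_computable_comp:
  assumes p: "partial_computable (length qs) p"
    and qs: "\<And>q. q \<in> set qs \<Longrightarrow> partial_computable k q"
  shows "partial_computable k
    (\<lambda>xs. if \<forall>q\<in>set qs. q xs \<noteq> None then p (map (\<lambda>q. the (q xs)) qs) else None)"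
proof -
  from p obtain c where c: "\<And>xs y. length xs = length qs \<Longrightarrow> p xs = Some y \<longleftrightarrow> evaluates c xs y"
    unfolding partial_computable_def by blast
  from qs have "\<forall>q\<in>set qs. \<exists>d. \<forall>xs. length xs = k \<longrightarrow> (\<forall>y. q xs = Some y \<longleftrightarrow> evaluates d xs y)"
    unfolding partial_computable_def by blast
  from bchoice[OF this] obtain d
    where d: "\<And>q xs y. q \<in> set qs \<Longrightarrow> length xs = k \<Longrightarrow> q xs = Some y \<longleftrightarrow> evaluates (d q) xs y"
    by blast
  have args: "list_all2 (\<lambda>g y. evaluates g xs y) (map d qs) ys \<longleftrightarrow>
      (\<forall>q\<in>set qs. q xs \<noteq> None) \<and> ys = map (\<lambda>q. the (q xs)) qs" if "length xs = k" for xs ys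
  proof -
    have "list_all2 (\<lambda>g y. evaluates g xs y) (map d qs) ys \<longleftrightarrow>
        list_all2 (\<lambda>q y. q xs = Some y) qs ys"
      using d that by (auto simp: list_all2_conv_all_nth)
    also have "\<dots> \<longleftrightarrow> (\<forall>q\<in>set qs. q xs \<noteq> None) \<and> ys = map (\<lambda>q. the (q xs)) qs"
      by (induction qs arbitrary: ys) (auto simp: list_all2_Cons1)
    finally show ?thesis .
  qed
  show ?thesis
    unfolding partial_computable_def
    by (rule exI[of _ "Comp c (map d qs)"]) (auto simp: evaluates_Comp_iff args c)
qed

lemma computable_fun_comp:
  assumes "computable_fun (length gs) f" "\<And>g. g \<in> set gs \<Longrightarrow> computable_fun k g"
  shows "computable_fun k (\<lambda>xs. f (map (\<lambda>g. g xs) gs))"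
proof -
  have "partial_computable k (\<lambda>xs. if \<forall>q\<in>set (map (\<lambda>g xs. Some (g xs)) gs). q xs \<noteq> None
     then Some (f (map (\<lambda>q. the (q xs)) (map (\<lambda>g xs. Some (g xs)) gs))) else None)"
    using assms unfolding computable_fun_def by (intro partial_computable_comp) auto
  then show ?thesis
    unfolding computable_fun_def by (rule partial_computable_cong) (auto simp: comp_def)
qed

text \<open>Minimisation searches for a zero, hence the negated characteristic function.\<close>

lemma partial_computable_Least:
  assumes "computable_fun (Suc k) (\<lambda>ys. 1 - char_fun {ys. P (hd ys) (tl ys)} ys)"
  shows "partial_computable k (\<lambda>xs. if \<exists>n. P n xs then Some (LEAST n. P n xs) else None)"
proof -
  from assms obtain c where
    c: "\<And>xs. length xs = Suc k \<Longrightarrow> evaluates c xs (1 - char_fun {ys. P (hd ys) (tl ys)} xs)"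
    by (rule computable_funE) blast
  have ev: "evaluates c (m # xs) v \<longleftrightarrow> v = (if P m xs then 0 else 1)" if "length xs = k" for m xs v
    using c[of "m # xs"] evaluates_functional that by (fastforce simp: char_fun_def split: if_splits)
  have "evaluates (Mu c) xs m \<longleftrightarrow> P m xs \<and> (\<forall>i<m. \<not> P i xs)" if "length xs = k" for m xs
    using that by (auto simp: evaluates_Mu_iff ev)
  moreover have "P m xs \<and> (\<forall>i<m. \<not> P i xs) \<longleftrightarrow> (\<exists>n. P n xs) \<and> (LEAST n. P n xs) = m" for m xs
    by (metis LeastI_ex Least_equality not_less_Least leI)
  ultimately show ?thesis
    unfolding partial_computable_def by (intro exI[of _ "Mu c"]) auto
qed

section \<open>A calculus of total computable functions and relations\<close>

lemma computable_const: "computable_fun k (\<lambda>xs. n)"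
proof (induction n)
  case 0
  show ?case by (rule computable_funI[of _ Zero]) (auto simp: evaluates_iffs)
next
  case (Suc n)
  have "computable_fun 1 (\<lambda>xs. Suc (xs ! 0))"
    by (rule computable_funI[of _ Succ]) (auto simp: evaluates_iffs length_Suc_conv)
  from computable_fun_comp[of "[\<lambda>xs. n]", OF _ ] this Suc show ?case by fastforce
qed

lemma computable_nth: "i < k \<Longrightarrow> computable_fun k (\<lambda>xs. xs ! i)"
  by (rule computable_funI[of _ "Proj i"]) (auto simp: evaluates_iffs)

lemma computable_comp1:
  assumes "computable_fun 1 (\<lambda>xs. F (xs ! 0))" "computable_fun k f"
  shows "computable_fun k (\<lambda>xs. F (f xs))"
  using computable_fun_comp[of "[f]" "\<lambda>xs. F (xs ! 0)" k] assms by simp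

lemma computable_comp2:
  assumes "computable_fun 2 (\<lambda>xs. F (xs ! 0) (xs ! 1))" "computable_fun k f" "computable_fun k g"
  shows "computable_fun k (\<lambda>xs. F (f xs) (g xs))"
proof -
  have "h \<in> set [f, g] \<Longrightarrow> computable_fun k h" for h using assms by auto
  with computable_fun_comp[of "[f, g]" "\<lambda>xs. F (xs ! 0) (xs ! 1)" k] assms(1) show ?thesis
    by (simp add: numeral_2_eq_2)
qed

lemma computable_hd: "computable_fun (Suc k) hd"
  by (rule computable_fun_cong[OF computable_nth[of 0]]) (auto simp: length_Suc_conv)

lemma computable_tl:
  assumes "computable_fun k f"
  shows "computable_fun (Suc k) (\<lambda>ys. f (tl ys))"
proof -
  have "computable_fun (Suc k) (\<lambda>ys. f (map (\<lambda>g. g ys) (map (\<lambda>i ys. ys ! Suc i) [0..<k])))"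
    by (rule computable_fun_comp) (use assms in \<open>auto intro: computable_nth\<close>)
  then show ?thesis
  proof (rule computable_fun_cong)
    fix ys :: "nat list" assume "length ys = Suc k"
    then have "map (\<lambda>i. ys ! Suc i) [0..<k] = tl ys"
      by (auto simp: nth_tl intro!: nth_equalityI)
    then show "f (map (\<lambda>g. g ys) (map (\<lambda>i ys. ys ! Suc i) [0..<k])) = f (tl ys)"
      by (simp add: comp_def)
  qed
qed

lemma computable_comp_app:
  assumes f: "computable_fun (length gs + k) f" and gs: "\<And>g. g \<in> set gs \<Longrightarrow> computable_fun k g"
  shows "computable_fun k (\<lambda>xs. f (map (\<lambda>g. g xs) gs @ xs))"
proof -
  have "computable_fun k (\<lambda>xs. f (map (\<lambda>g. g xs) (gs @ map (\<lambda>i xs. xs ! i) [0..<k])))"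
    by (rule computable_fun_comp) (use f gs in \<open>auto intro: computable_nth\<close>)
  then show ?thesis
  proof (rule computable_fun_cong)
    fix xs :: "nat list" assume "length xs = k"
    then have "map (\<lambda>i. xs ! i) [0..<k] = xs" using map_nth by blast
    then show "f (map (\<lambda>g. g xs) (gs @ map (\<lambda>i xs. xs ! i) [0..<k])) = f (map (\<lambda>g. g xs) gs @ xs)"
      by (simp add: comp_def)
  qed
qed

lemma computable_comp_Cons:
  assumes "computable_fun (Suc k) (\<lambda>ys. F (hd ys) (tl ys))" "computable_fun k g"
  shows "computable_fun k (\<lambda>xs. F (g xs) xs)"
  using computable_comp_app[of "[g]" k "\<lambda>ys. F (hd ys) (tl ys)"] assms by simp

text \<open>Primitive recursion, with the parameters \<open>xs\<close> available to the step function and to the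
  expression \<open>n\<close> that bounds the recursion.\<close>

lemma computable_rec_nat:
  assumes b: "computable_fun k b"
    and st: "computable_fun (Suc (Suc k)) (\<lambda>ys. st (ys ! 0) (ys ! 1) (tl (tl ys)))"
    and n: "computable_fun k n"
  shows "computable_fun k (\<lambda>xs. rec_nat (b xs) (\<lambda>m r. st m r xs) (n xs))"
proof -
  from b obtain c where c: "\<And>xs. length xs = k \<Longrightarrow> evaluates c xs (b xs)"
    by (rule computable_funE) blast
  from st obtain d where
    d: "\<And>xs. length xs = Suc (Suc k) \<Longrightarrow> evaluates d xs (st (xs ! 0) (xs ! 1) (tl (tl xs)))"
    by (rule computable_funE) blast
  have "evaluates (PrimRec c d) (m # xs) (rec_nat (b xs) (\<lambda>m r. st m r xs) m)"
    if "length xs = k" for m xs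
  proof (induction m)
    case 0 show ?case using c that by (simp add: evaluates_iffs)
  next
    case (Suc m)
    let ?r = "rec_nat (b xs) (\<lambda>m r. st m r xs) m"
    have "evaluates d (m # ?r # xs) (st m ?r xs)" using d[of "m # ?r # xs"] that by simp
    with Suc show ?case by (auto simp: evaluates_iffs)
  qed
  then have "computable_fun (Suc k) (\<lambda>ys. rec_nat (b (tl ys)) (\<lambda>m r. st m r (tl ys)) (hd ys))"
    by (intro computable_funI[of _ "PrimRec c d"]) (auto simp: length_Suc_conv)
  from computable_comp_Cons[OF this n] show ?thesis .
qed

lemma computable_Suc: "computable_fun k f \<Longrightarrow> computable_fun k (\<lambda>xs. Suc (f xs))"
  by (rule computable_comp1)
    (auto intro!: computable_funI[of _ Succ] simp: evaluates_iffs length_Suc_conv)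

lemma computable_add:
  assumes "computable_fun k f" "computable_fun k g"
  shows "computable_fun k (\<lambda>xs. f xs + g xs)"
proof -
  have "computable_fun k (\<lambda>xs. rec_nat (f xs) (\<lambda>m r. Suc r) (g xs))"
    by (intro computable_rec_nat computable_Suc computable_nth assms) auto
  moreover have "rec_nat a (\<lambda>m r. Suc r) b = a + b" for a b by (induction b) auto
  ultimately show ?thesis by simp
qed

lemma computable_mult:
  assumes "computable_fun k f" "computable_fun k g"
  shows "computable_fun k (\<lambda>xs. f xs * g xs)"
proof -
  have "computable_fun 2 (\<lambda>xs. rec_nat 0 (\<lambda>m r. r + xs ! 0) (xs ! 1))"
    by (rule computable_rec_nat[of _ _ "\<lambda>m r xs. r + xs ! 0"],
        intro computable_const,
        rule computable_fun_cong[of _ "\<lambda>ys. ys ! 1 + ys ! 2"],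
        intro computable_add computable_nth)
      (auto simp: nth_tl intro: computable_nth simp flip: numeral_2_eq_2)
  moreover have "rec_nat 0 (\<lambda>m r. r + a) b = a * b" for a b :: nat by (induction b) auto
  ultimately have "computable_fun 2 (\<lambda>xs. xs ! 0 * xs ! 1)" by simp
  from computable_comp2[OF this assms] show ?thesis .
qed

lemma computable_diff:
  assumes "computable_fun k f" "computable_fun k g"
  shows "computable_fun k (\<lambda>xs. f xs - g xs)"
proof -
  have "computable_fun 1 (\<lambda>xs. rec_nat 0 (\<lambda>m r. m) (xs ! 0))"
    by (intro computable_rec_nat computable_const computable_nth) auto
  moreover have "rec_nat 0 (\<lambda>m r. m) a = a - 1" for a :: nat by (cases a) auto
  ultimately have pred: "computable_fun 1 (\<lambda>xs. xs ! 0 - 1)" by simp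
  have "computable_fun k (\<lambda>xs. rec_nat (f xs) (\<lambda>m r. r - 1) (g xs))"
    by (intro computable_rec_nat computable_comp1[OF pred] computable_nth assms) auto
  moreover have "rec_nat a (\<lambda>m r. r - 1) b = a - b" for a b :: nat by (induction b) auto
  ultimately show ?thesis by simp
qed

lemma computable_relI:
  assumes "computable_fun k (\<lambda>xs. of_bool (P xs))"
  shows "computable_rel k {xs. P xs}"
  using assms unfolding computable_rel_def
  by (rule computable_fun_cong) (simp add: char_fun_def)

lemma computable_relD:
  assumes "computable_rel k {xs. P xs}"
  shows "computable_fun k (\<lambda>xs. of_bool (P xs))"
  using assms unfolding computable_rel_def
  by (rule computable_fun_cong) (simp add: char_fun_def)

lemma computable_rel_cong:
  assumes "computable_rel k R" "\<And>xs. length xs = k \<Longrightarrow> xs \<in> R \<longleftrightarrow> xs \<in> S"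
  shows "computable_rel k S"
  using assms(1) unfolding computable_rel_def
  by (rule computable_fun_cong) (simp add: char_fun_def assms(2))

lemma computable_le:
  assumes "computable_fun k f" "computable_fun k g"
  shows "computable_rel k {xs. f xs \<le> g xs}"
proof -
  have "of_bool (a \<le> b) = 1 - (a - b)" for a b :: nat by auto
  then show ?thesis
    by (intro computable_relI) (simp add: computable_diff computable_const assms)
qed

lemma computable_Not:
  assumes "computable_rel k {xs. P xs}"
  shows "computable_rel k {xs. \<not> P xs}"
  by (intro computable_relI, rule computable_fun_cong[of _ "\<lambda>xs. 1 - of_bool (P xs)"],
      intro computable_diff computable_const computable_relD assms) auto

lemma computable_conj:
  assumes "computable_rel k {xs. P xs}" "computable_rel k {xs. Q xs}"
  shows "computable_rel k {xs. P xs \<and> Q xs}"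
  by (intro computable_relI, rule computable_fun_cong[of _ "\<lambda>xs. of_bool (P xs) * of_bool (Q xs)"],
      intro computable_mult computable_relD assms) auto

lemma computable_disj:
  assumes "computable_rel k {xs. P xs}" "computable_rel k {xs. Q xs}"
  shows "computable_rel k {xs. P xs \<or> Q xs}"
  using computable_Not[OF computable_conj[OF computable_Not[OF assms(1)] computable_Not[OF assms(2)]]]
  by simp

lemma computable_less:
  assumes "computable_fun k f" "computable_fun k g"
  shows "computable_rel k {xs. f xs < g xs}"
  using computable_Not[OF computable_le[OF assms(2,1)]] by (simp add: not_le)

lemma computable_eq:
  assumes "computable_fun k f" "computable_fun k g"
  shows "computable_rel k {xs. f xs = g xs}"
  using computable_conj[OF computable_le[OF assms] computable_le[OF assms(2,1)]]
  by (simp flip: eq_iff)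

lemma computable_If:
  assumes "computable_rel k {xs. P xs}" "computable_fun k f" "computable_fun k g"
  shows "computable_fun k (\<lambda>xs. if P xs then f xs else g xs)"
  by (rule computable_fun_cong[of _ "\<lambda>xs. of_bool (P xs) * f xs + of_bool (\<not> P xs) * g xs"],
      intro computable_add computable_mult computable_relD computable_Not assms) auto

lemma computable_partial_Least:
  assumes "computable_rel (Suc k) {ys. P (hd ys) (tl ys)}"
  shows "partial_computable k (\<lambda>xs. if \<exists>n. P n xs then Some (LEAST n. P n xs) else None)"
  by (rule partial_computable_Least, rule computable_diff[OF computable_const])
    (use assms computable_rel_def in blast)

lemma computable_Least:
  assumes "computable_rel (Suc k) {ys. P (hd ys) (tl ys)}" "\<And>xs. length xs = k \<Longrightarrow> \<exists>n. P n xs"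
  shows "computable_fun k (\<lambda>xs. LEAST n. P n xs)"
  unfolding computable_fun_def
  by (rule partial_computable_cong[OF computable_partial_Least[OF assms(1)]]) (use assms(2) in auto)

text \<open>Bounded quantifiers reduce to minimisation: the least \<open>i\<close> that is \<open>n\<close> or a counterexample
  equals \<open>n\<close> exactly if there is no counterexample below \<open>n\<close>.\<close>

lemma computable_ball_less:
  assumes P: "computable_rel (Suc k) {ys. P (hd ys) (tl ys)}"
    and n: "computable_fun k n"
  shows "computable_rel k {xs. \<forall>i<n xs. P i xs}"
proof -
  have "computable_fun k (\<lambda>xs. LEAST i. i = n xs \<or> \<not> P i xs)"
    by (intro computable_Least computable_disj computable_eq computable_Not computable_hd computable_tl
        n P) auto
  from computable_eq[OF this n] show ?thesis
  proof (rule computable_rel_cong)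
    fix xs
    let ?l = "LEAST i. i = n xs \<or> \<not> P i xs"
    have "?l = n xs \<or> \<not> P ?l xs" by (rule LeastI) blast
    moreover have "?l \<le> n xs" by (rule Least_le) blast
    moreover have "i = n xs \<or> \<not> P i xs \<Longrightarrow> ?l \<le> i" for i by (rule Least_le)
    ultimately have "?l = n xs \<longleftrightarrow> (\<forall>i<n xs. P i xs)"
      by (metis leD nat_less_le)
    then show "xs \<in> {xs. (LEAST i. i = n xs \<or> \<not> P i xs) = n xs} \<longleftrightarrow>
        xs \<in> {xs. \<forall>i<n xs. P i xs}"
      by simp
  qed
qed

section \<open>Stages of computations\<close>

text \<open>
  \<open>stage_eval c s xs\<close> is the approximation of the value of \<open>c\<close> at \<open>xs\<close> in which every unbounded
  search is cut off at \<open>s\<close>; \<open>0\<close> stands for divergence and \<open>Suc y\<close> for the value \<open>y\<close>. No coding of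
  computation histories is needed because \<open>c\<close> is fixed: by recursion on \<open>c\<close>, each of these functions is
  primitive recursive.
\<close>

primrec stage_eval :: "recf \<Rightarrow> nat \<Rightarrow> nat list \<Rightarrow> nat" where
  "stage_eval Zero s xs = 1"
| "stage_eval Succ s xs = (case xs of [x] \<Rightarrow> Suc (Suc x) | _ \<Rightarrow> 0)"
| "stage_eval (Proj i) s xs = (if i < length xs then Suc (xs ! i) else 0)"
| "stage_eval (Comp f gs) s xs =
     (if \<forall>v\<in>set (map (\<lambda>h. h s xs) (map stage_eval gs)). v \<noteq> 0
      then stage_eval f s (map (\<lambda>v. v - 1) (map (\<lambda>h. h s xs) (map stage_eval gs))) else 0)"
| "stage_eval (PrimRec f g) s xs =
     (case xs of [] \<Rightarrow> 0
      | m # xs \<Rightarrow> rec_nat (stage_eval f s xs)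
          (\<lambda>m r. if r = 0 then 0 else stage_eval g s (m # (r - 1) # xs)) m)"
| "stage_eval (Mu f) s xs =
     (let m = (LEAST m. m = s \<or> stage_eval f s (m # xs) \<le> 1)
      in if stage_eval f s (m # xs) = 1 then Suc m else 0)"

lemma stage_eval_Comp_eq_Suc:
  "stage_eval (Comp f gs) s xs = Suc z \<longleftrightarrow>
     (\<exists>ys. list_all2 (\<lambda>g y. stage_eval g s xs = Suc y) gs ys \<and> stage_eval f s ys = Suc z)"
proof -
  have "list_all2 (\<lambda>g y. stage_eval g s xs = Suc y) gs ys \<longleftrightarrow>
      (\<forall>g\<in>set gs. stage_eval g s xs \<noteq> 0) \<and> ys = map (\<lambda>g. stage_eval g s xs - 1) gs" for ys
    by (induction gs arbitrary: ys) (auto simp: list_all2_Cons1)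
  then show ?thesis by (auto simp: comp_def)
qed

lemma stage_eval_PrimRec_Suc_eq_Suc:
  "stage_eval (PrimRec f g) s (Suc m # xs) = Suc z \<longleftrightarrow>
     (\<exists>r. stage_eval (PrimRec f g) s (m # xs) = Suc r \<and> stage_eval g s (m # r # xs) = Suc z)"
  by (auto simp: gr0_conv_Suc)

text \<open>The bounded search stops at the first candidate whose value is \<open>0\<close> or not yet known, so it
  succeeds only if all smaller candidates are known to have positive values.\<close>

lemma stage_eval_Mu_eq_Suc:
  "stage_eval (Mu f) s xs = Suc m \<longleftrightarrow>
     m \<le> s \<and> stage_eval f s (m # xs) = 1 \<and> (\<forall>i<m. \<exists>y. stage_eval f s (i # xs) = Suc (Suc y))"
proof -
  let ?P = "\<lambda>m. m = s \<or> stage_eval f s (m # xs) \<le> 1"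
  let ?l = "LEAST m. ?P m"
  have l: "?P ?l" by (rule LeastI) blast
  have le: "?P i \<Longrightarrow> ?l \<le> i" for i by (rule Least_le)
  have ge2: "(\<exists>y. v = Suc (Suc y)) \<longleftrightarrow> \<not> v \<le> 1" for v :: nat
    by (auto simp: not_le dest!: less_imp_Suc_add)
  have eq: "stage_eval (Mu f) s xs = Suc m \<longleftrightarrow> m = ?l \<and> stage_eval f s (m # xs) = 1"
    by (auto simp: Let_def)
  have "m = ?l \<longleftrightarrow> m \<le> s \<and> (\<forall>i<m. \<not> stage_eval f s (i # xs) \<le> 1)"
    if "stage_eval f s (m # xs) = 1"
  proof
    assume m: "m = ?l"
    have "\<not> ?P i" if "i < m" for i using le[of i] that unfolding m by linarith
    moreover have "m \<le> s" using le[of s] unfolding m by simp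
    ultimately show "m \<le> s \<and> (\<forall>i<m. \<not> stage_eval f s (i # xs) \<le> 1)" by blast
  next
    assume m: "m \<le> s \<and> (\<forall>i<m. \<not> stage_eval f s (i # xs) \<le> 1)"
    have "?l \<le> m" using le[of m] that by simp
    moreover have "\<not> ?l < m" using l m by auto
    ultimately show "m = ?l" by simp
  qed
  then show ?thesis unfolding eq ge2 by auto
qed

text \<open>Raising the cut-off does not disturb a completed search: at the new stage all earlier candidates
  still evaluate to positive values.\<close>

lemma stage_eval_mono:
  "stage_eval c s xs = Suc y \<Longrightarrow> s \<le> t \<Longrightarrow> stage_eval c t xs = Suc y"
proof (induction c arbitrary: xs y)
  case Zero then show ?case by simp
next
  case Succ then show ?case by simp
next
  case Proj then show ?case by simp
next
  case (Comp f gs)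
  from Comp.prems(1) obtain ys where
    ys: "list_all2 (\<lambda>g y. stage_eval g s xs = Suc y) gs ys" "stage_eval f s ys = Suc y"
    unfolding stage_eval_Comp_eq_Suc by blast
  have "list_all2 (\<lambda>g y. stage_eval g t xs = Suc y) gs ys"
    by (rule list.rel_mono_strong[OF ys(1)]) (rule Comp.IH(2)[OF _ _ Comp.prems(2)])
  with Comp.IH(1)[OF ys(2) Comp.prems(2)] show ?case unfolding stage_eval_Comp_eq_Suc by blast
next
  case (PrimRec f g)
  show ?case
  proof (cases xs)
    case Nil with PrimRec show ?thesis by simp
  next
    case (Cons m zs)
    from PrimRec.prems(1)[unfolded Cons] have "stage_eval (PrimRec f g) t (m # zs) = Suc y"
    proof (induction m arbitrary: y)
      case 0 with PrimRec.IH(1) PrimRec.prems(2) show ?case by simp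
    next
      case (Suc m)
      with PrimRec.IH(2) PrimRec.prems(2) show ?case
        unfolding stage_eval_PrimRec_Suc_eq_Suc by blast
    qed
    with Cons show ?thesis by simp
  qed
next
  case (Mu f)
  have 1: "stage_eval f s (y # xs) = Suc 0" "\<forall>i<y. \<exists>v. stage_eval f s (i # xs) = Suc (Suc v)" "y \<le> s"
    using Mu.prems(1) unfolding stage_eval_Mu_eq_Suc by auto
  have "stage_eval f t (y # xs) = Suc 0" "\<forall>i<y. \<exists>v. stage_eval f t (i # xs) = Suc (Suc v)"
    using 1 Mu.IH Mu.prems(2) by blast+
  with 1(3) Mu.prems(2) show ?case unfolding stage_eval_Mu_eq_Suc by simp
qed

lemma stage_eval_sound: "stage_eval c s xs = Suc y \<Longrightarrow> evaluates c xs y"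
proof (induction c arbitrary: xs y)
  case Zero then show ?case by (simp add: evaluates_iffs)
next
  case Succ then show ?case by (auto simp: evaluates_iffs split: list.splits)
next
  case Proj then show ?case by (simp add: evaluates_iffs split: if_splits)
next
  case (Comp f gs)
  from Comp.prems(1) obtain ys where
    ys: "list_all2 (\<lambda>g y. stage_eval g s xs = Suc y) gs ys" "stage_eval f s ys = Suc y"
    unfolding stage_eval_Comp_eq_Suc by blast
  have "list_all2 (\<lambda>g y. evaluates g xs y) gs ys"
    by (rule list.rel_mono_strong[OF ys(1)]) (rule Comp.IH(2))
  then show ?case using Comp.IH(1)[OF ys(2)] by (rule evaluates.Comp)
next
  case (PrimRec f g)
  show ?case
  proof (cases xs)
    case Nil with PrimRec show ?thesis by simp
  next
    case (Cons m zs)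
    from PrimRec.prems(1)[unfolded Cons] have "evaluates (PrimRec f g) (m # zs) y"
    proof (induction m arbitrary: y)
      case 0 with PrimRec.IH(1) show ?case by (simp add: evaluates_iffs)
    next
      case (Suc m)
      with PrimRec.IH(2) show ?case
        unfolding stage_eval_PrimRec_Suc_eq_Suc evaluates_PrimRec_Suc_iff by blast
    qed
    with Cons show ?thesis by simp
  qed
next
  case (Mu f)
  have "stage_eval f s (y # xs) = Suc 0" "\<forall>i<y. \<exists>v. stage_eval f s (i # xs) = Suc (Suc v)"
    using Mu.prems unfolding stage_eval_Mu_eq_Suc by auto
  then show ?case unfolding evaluates_Mu_iff using Mu.IH by blast
qed

text \<open>Finitely many converging computations have a common stage, by monotonicity.\<close>

lemma stage_eval_complete: "evaluates c xs y \<Longrightarrow> \<exists>s. stage_eval c s xs = Suc y"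
proof (induction rule: evaluates.induct)
  case (Comp xs gs ys f z)
  then obtain s where s: "stage_eval f s ys = Suc z" by blast
  have "\<exists>t. list_all2 (\<lambda>g y. stage_eval g t xs = Suc y) gs ys"
    using Comp.IH(1)
  proof (induction rule: list_all2_induct)
    case (Cons g gs y ys)
    then obtain t u where t: "list_all2 (\<lambda>g y. stage_eval g t xs = Suc y) gs ys"
      and u: "stage_eval g u xs = Suc y" by blast
    have "list_all2 (\<lambda>g y. stage_eval g (max t u) xs = Suc y) gs ys"
      by (rule list.rel_mono_strong[OF t]) (auto intro: stage_eval_mono)
    moreover have "stage_eval g (max t u) xs = Suc y" by (rule stage_eval_mono[OF u]) simp
    ultimately show ?case by auto
  qed simp
  then obtain t where t: "list_all2 (\<lambda>g y. stage_eval g t xs = Suc y) gs ys" ..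
  have "list_all2 (\<lambda>g y. stage_eval g (max s t) xs = Suc y) gs ys"
    by (rule list.rel_mono_strong[OF t]) (auto intro: stage_eval_mono)
  moreover have "stage_eval f (max s t) ys = Suc z" by (rule stage_eval_mono[OF s]) simp
  ultimately show ?case unfolding stage_eval_Comp_eq_Suc by blast
next
  case (PrimRec_0 f xs y g)
  then show ?case by simp
next
  case (PrimRec_Suc f g m xs r y)
  then obtain s t where "stage_eval (PrimRec f g) s (m # xs) = Suc r"
    "stage_eval g t (m # r # xs) = Suc y" by blast
  then have "stage_eval (PrimRec f g) (max s t) (m # xs) = Suc r"
    "stage_eval g (max s t) (m # r # xs) = Suc y"
    by (auto intro: stage_eval_mono simp del: stage_eval.simps)
  then show ?case unfolding stage_eval_PrimRec_Suc_eq_Suc by blast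
next
  case (Mu f m xs)
  then obtain s where s: "stage_eval f s (m # xs) = 1" by auto
  have "\<forall>i<m. \<exists>y s. stage_eval f s (i # xs) = Suc (Suc y)" using Mu.IH(2) by blast
  then obtain y t where t: "\<And>i. i < m \<Longrightarrow> stage_eval f (t i) (i # xs) = Suc (Suc (y i))" by metis
  define u where "u = Max ({s, m} \<union> t ` {..<m})"
  have u: "s \<le> u" "m \<le> u" "\<And>i. i < m \<Longrightarrow> t i \<le> u" unfolding u_def by (intro Max_ge; simp)+
  have "stage_eval f u (m # xs) = 1" using stage_eval_mono[OF _ u(1)] s by simp
  moreover have "\<forall>i<m. \<exists>y. stage_eval f u (i # xs) = Suc (Suc y)"
    using stage_eval_mono[OF t u(3)] by blast
  ultimately have "stage_eval (Mu f) u xs = Suc m" using u(2) unfolding stage_eval_Mu_eq_Suc by simp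
  then show ?case ..
qed auto

lemma computable_comp_list:
  assumes "computable_fun (Suc (length gs)) (\<lambda>ys. F (hd ys) (tl ys))"
    "computable_fun k f" "\<And>g. g \<in> set gs \<Longrightarrow> computable_fun k g"
  shows "computable_fun k (\<lambda>xs. F (f xs) (map (\<lambda>g. g xs) gs))"
proof -
  have "computable_fun k (\<lambda>xs. F (hd (map (\<lambda>g. g xs) (f # gs))) (tl (map (\<lambda>g. g xs) (f # gs))))"
    by (rule computable_fun_comp) (use assms in auto)
  then show ?thesis by simp
qed

lemma computable_list_all:
  assumes "\<And>P. P \<in> set Ps \<Longrightarrow> computable_rel k {xs. P xs}"
  shows "computable_rel k {xs. \<forall>P\<in>set Ps. P xs}"
  using assms
proof (induction Ps)
  case Nil
  show ?case by (rule computable_relI) (simp add: computable_const)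
qed (auto intro: computable_conj)

lemma computable_stage_eval: "computable_fun (Suc k) (\<lambda>ys. stage_eval c (hd ys) (tl ys))"
proof (induction c arbitrary: k)
  case Zero
  show ?case by (simp add: computable_const)
next
  case Succ
  show ?case
  proof (cases "k = 1")
    case True
    have "computable_fun (Suc k) (\<lambda>ys. Suc (Suc (ys ! 1)))"
      using True by (intro computable_Suc computable_nth) simp
    then show ?thesis by (rule computable_fun_cong) (auto simp: True length_Suc_conv)
  next
    case False
    show ?thesis
      by (rule computable_fun_cong[OF computable_const[of _ 0]])
        (use False in \<open>auto simp: length_Suc_conv split: list.splits\<close>)
  qed
next
  case (Proj i)
  show ?case
  proof (cases "i < k")
    case True
    show ?thesis
      by (rule computable_fun_cong[of _ "\<lambda>ys. Suc (ys ! Suc i)"], intro computable_Suc computable_nth)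
        (use True in \<open>auto simp: nth_tl\<close>)
  next
    case False
    show ?thesis
      by (rule computable_fun_cong[OF computable_const[of _ 0]]) (use False in auto)
  qed
next
  case (Comp f gs)
  let ?hs = "map (\<lambda>g ys. stage_eval g (hd ys) (tl ys) - 1) gs"
  let ?Ps = "map (\<lambda>g ys. stage_eval g (hd ys) (tl ys) \<noteq> 0) gs"
  have "computable_fun (Suc k) (\<lambda>ys. stage_eval f (hd ys) (map (\<lambda>h. h ys) ?hs))"
    by (rule computable_comp_list[where F = "stage_eval f"])
      (use Comp in \<open>auto intro!: computable_hd computable_diff computable_const\<close>)
  moreover have "computable_rel (Suc k) {ys. \<forall>P\<in>set ?Ps. P ys}"
    by (rule computable_list_all)
      (use Comp in \<open>auto intro!: computable_Not computable_eq computable_const simp del: neq0_conv\<close>)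
  ultimately have "computable_fun (Suc k)
      (\<lambda>ys. if \<forall>P\<in>set ?Ps. P ys then stage_eval f (hd ys) (map (\<lambda>h. h ys) ?hs) else 0)"
    by (intro computable_If computable_const)
  then show ?case by (rule computable_fun_cong) (auto simp: comp_def)
next
  case (PrimRec f g)
  show ?case
  proof (cases k)
    case 0
    show ?thesis
      by (rule computable_fun_cong[OF computable_const[of _ 0]]) (auto simp: 0 length_Suc_conv)
  next
    case (Suc j)
    have f: "computable_fun (Suc k) (\<lambda>ys. stage_eval f (hd ys) (tl (tl ys)))"
    proof (rule computable_fun_cong)
      show "computable_fun (Suc k) (\<lambda>ys. stage_eval f (hd ys)
          (map (\<lambda>h. h ys) (map (\<lambda>i ys. ys ! Suc (Suc i)) [0..<j])))"
        by (rule computable_comp_list[where F = "stage_eval f"])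
          (use PrimRec(1) Suc in \<open>auto intro!: computable_hd computable_nth\<close>)
      fix ys :: "nat list" assume "length ys = Suc k"
      then have "map (\<lambda>i. ys ! Suc (Suc i)) [0..<j] = tl (tl ys)"
        by (auto simp: nth_tl Suc intro!: nth_equalityI)
      then show "stage_eval f (hd ys) (map (\<lambda>h. h ys) (map (\<lambda>i ys. ys ! Suc (Suc i)) [0..<j])) =
          stage_eval f (hd ys) (tl (tl ys))" by (simp add: comp_def)
    qed
    have g: "computable_fun (Suc (Suc (Suc k)))
        (\<lambda>zs. if zs ! 1 = 0 then 0
          else stage_eval g (hd (tl (tl zs))) (zs ! 0 # (zs ! 1 - 1) # tl (tl (tl (tl zs)))))"
    proof (rule computable_fun_cong)
      let ?gs = "(\<lambda>zs. zs ! 0) # (\<lambda>zs. zs ! 1 - 1) # map (\<lambda>i zs. zs ! (4 + i)) [0..<j]"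
      have "computable_fun (Suc (Suc (Suc k))) (\<lambda>zs. stage_eval g (zs ! 2) (map (\<lambda>h. h zs) ?gs))"
        by (rule computable_comp_list[where F = "stage_eval g"])
          (use PrimRec(2) Suc in \<open>auto intro!: computable_nth computable_diff computable_const\<close>)
      then show "computable_fun (Suc (Suc (Suc k)))
          (\<lambda>zs. if zs ! 1 = 0 then 0 else stage_eval g (zs ! 2) (map (\<lambda>h. h zs) ?gs))"
        by (rule computable_If[rotated 2])
          (use Suc in \<open>auto intro!: computable_eq computable_nth computable_const\<close>)
      fix zs :: "nat list" assume zs: "length zs = Suc (Suc (Suc k))"
      then have "map (\<lambda>i. zs ! (4 + i)) [0..<j] = tl (tl (tl (tl zs)))" "zs ! 2 = hd (tl (tl zs))"
        by (auto simp: nth_tl Suc numeral_eq_Suc length_Suc_conv intro!: nth_equalityI)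
      then show "(if zs ! 1 = 0 then 0 else stage_eval g (zs ! 2) (map (\<lambda>h. h zs) ?gs)) =
          (if zs ! 1 = 0 then 0 else stage_eval g (hd (tl (tl zs)))
            (zs ! 0 # (zs ! 1 - 1) # tl (tl (tl (tl zs)))))"
        by (simp add: comp_def)
    qed
    have "computable_fun (Suc k) (\<lambda>ys. rec_nat (stage_eval f (hd ys) (tl (tl ys)))
        (\<lambda>m r. if r = 0 then 0 else stage_eval g (hd ys) (m # (r - 1) # tl (tl ys))) (ys ! 1))"
      by (rule computable_rec_nat[where
            st = "\<lambda>m r ys. if r = 0 then 0 else stage_eval g (hd ys) (m # (r - 1) # tl (tl ys))"],
          rule f, rule g, rule computable_nth) (simp add: Suc)
    then show ?thesis
      by (rule computable_fun_cong) (auto simp: Suc length_Suc_conv cong: if_cong)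
  qed
next
  case (Mu f)
  have f: "computable_fun (Suc (Suc k)) (\<lambda>zs. stage_eval f (hd (tl zs)) (hd zs # tl (tl zs)))"
  proof (rule computable_fun_cong)
    let ?gs = "(\<lambda>zs. zs ! 0) # map (\<lambda>i zs. zs ! (2 + i)) [0..<k]"
    show "computable_fun (Suc (Suc k)) (\<lambda>zs. stage_eval f (zs ! 1) (map (\<lambda>h. h zs) ?gs))"
      by (rule computable_comp_list[where F = "stage_eval f"]) (use Mu in \<open>auto intro!: computable_nth\<close>)
    fix zs :: "nat list" assume zs: "length zs = Suc (Suc k)"
    then have "map (\<lambda>i. zs ! (2 + i)) [0..<k] = tl (tl zs)" "zs ! 1 = hd (tl zs)" "zs ! 0 = hd zs"
      by (auto simp: nth_tl length_Suc_conv intro!: nth_equalityI)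
    then show "stage_eval f (zs ! 1) (map (\<lambda>h. h zs) ?gs) =
        stage_eval f (hd (tl zs)) (hd zs # tl (tl zs))" by (simp add: comp_def)
  qed
  let ?m = "\<lambda>ys. LEAST m. m = hd ys \<or> stage_eval f (hd ys) (m # tl ys) \<le> 1"
  have m: "computable_fun (Suc k) ?m"
  proof (rule computable_Least)
    show "computable_rel (Suc (Suc k))
        {zs. hd zs = hd (tl zs) \<or> stage_eval f (hd (tl zs)) (hd zs # tl (tl zs)) \<le> 1}"
      by (intro computable_disj computable_eq computable_le computable_const f computable_hd
          computable_tl)
  qed blast
  have "computable_fun (Suc k) (\<lambda>ys. stage_eval f (hd ys) (?m ys # tl ys))"
    using computable_comp_Cons[of "Suc k" "\<lambda>m ys. stage_eval f (hd ys) (m # tl ys)", OF f m] .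
  then have "computable_fun (Suc k)
      (\<lambda>ys. if stage_eval f (hd ys) (?m ys # tl ys) = 1 then Suc (?m ys) else 0)"
    by (intro computable_If computable_eq computable_const computable_Suc m)
  then show ?case by (simp only: stage_eval.simps Let_def)
qed

section \<open>Computably enumerable relations\<close>

abbreviation computable_map :: "(nat \<Rightarrow> nat) \<Rightarrow> bool" where
  "computable_map g \<equiv> computable_fun 1 (\<lambda>xs. g (xs ! 0))"

abbreviation partial_computable_map :: "(nat \<Rightarrow> nat option) \<Rightarrow> bool" where
  "partial_computable_map \<phi> \<equiv> partial_computable 1 (\<lambda>xs. \<phi> (xs ! 0))"

text \<open>A c.e. relation is the union of an increasing computable sequence of stages. Several c.e. relations can
  therefore be searched in parallel by running through the stages.\<close>

lemma ce_relE:
  assumes "ce_rel k R"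
  obtains H where "computable_rel (Suc k) {ys. H (hd ys) (tl ys)}"
    "\<And>xs. length xs = k \<Longrightarrow> xs \<in> R \<longleftrightarrow> (\<exists>s. H s xs)"
    "\<And>xs s t. H s xs \<Longrightarrow> s \<le> t \<Longrightarrow> H t xs"
proof -
  from assms obtain c where c: "\<And>xs. length xs = k \<Longrightarrow> xs \<in> R \<longleftrightarrow> (\<exists>y. evaluates c xs y)"
    unfolding ce_rel_def partial_computable_def by (metis not_None_eq)
  show thesis
  proof (rule that[of "\<lambda>s xs. stage_eval c s xs \<noteq> 0"])
    show "computable_rel (Suc k) {ys. stage_eval c (hd ys) (tl ys) \<noteq> 0}"
      by (intro computable_Not computable_eq computable_stage_eval computable_const)
    show "xs \<in> R \<longleftrightarrow> (\<exists>s. stage_eval c s xs \<noteq> 0)" if "length xs = k" for xs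
      using c[OF that] stage_eval_complete stage_eval_sound by (metis nat.distinct(1) not0_implies_Suc)
    show "stage_eval c t xs \<noteq> 0" if "stage_eval c s xs \<noteq> 0" "s \<le> t" for s t xs
      using that stage_eval_mono by (metis nat.distinct(1) not0_implies_Suc)
  qed
qed

lemma ce_relI:
  assumes "computable_rel (Suc k) {ys. H (hd ys) (tl ys)}"
    "\<And>xs. length xs = k \<Longrightarrow> xs \<in> R \<longleftrightarrow> (\<exists>s. H s xs)"
  shows "ce_rel k R"
  unfolding ce_rel_def using computable_partial_Least[OF assms(1)] assms(2)
  by (intro exI[of _ "\<lambda>xs. if \<exists>s. H s xs then Some (LEAST s. H s xs) else None"]) auto

lemma ce_rel_cong:
  assumes "ce_rel k R" "\<And>xs. length xs = k \<Longrightarrow> xs \<in> R \<longleftrightarrow> xs \<in> S"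
  shows "ce_rel k S"
  using assms unfolding ce_rel_def by metis

lemma computable_imp_ce_rel:
  assumes "computable_rel k R"
  shows "ce_rel k R"
proof (rule ce_relI)
  have "computable_rel k {xs. xs \<in> R}" using assms by simp
  from computable_eq[OF computable_tl[OF computable_relD[OF this]] computable_const[of _ 1]]
  show "computable_rel (Suc k) {ys. (\<lambda>s xs. xs \<in> R) (hd ys) (tl ys)}"
    by (simp del: One_nat_def)
qed simp

text \<open>Post's theorem: search for a stage at which \<open>xs\<close> has entered \<open>R\<close> or the complement, and then
  read off which of the two it was.\<close>

lemma computable_relI_Post:
  assumes R: "ce_rel k R" and S: "ce_rel k S"
    and compl: "\<And>xs. length xs = k \<Longrightarrow> xs \<in> S \<longleftrightarrow> xs \<notin> R"
  shows "computable_rel k R"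
proof -
  from R obtain H where H: "computable_rel (Suc k) {ys. H (hd ys) (tl ys)}"
    "\<And>xs. length xs = k \<Longrightarrow> xs \<in> R \<longleftrightarrow> (\<exists>s. H s xs)" by (rule ce_relE) blast
  from S obtain G where G: "computable_rel (Suc k) {ys. G (hd ys) (tl ys)}"
    "\<And>xs. length xs = k \<Longrightarrow> xs \<in> S \<longleftrightarrow> (\<exists>s. G s xs)" by (rule ce_relE) blast
  let ?s = "\<lambda>xs. LEAST s. H s xs \<or> G s xs"
  have ex: "\<exists>s. H s xs \<or> G s xs" if "length xs = k" for xs
    using H(2) G(2) compl that by blast
  have "computable_fun k ?s"
    by (intro computable_Least computable_disj H(1) G(1) ex)
  then have "computable_fun k (\<lambda>xs. of_bool (H (?s xs) xs))"
    by (rule computable_comp_Cons[where F = "\<lambda>s xs. of_bool (H s xs)", OF computable_relD[OF H(1)]])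
  from computable_relI[OF this] show ?thesis
  proof (rule computable_rel_cong)
    fix xs :: "nat list" assume xs: "length xs = k"
    have "H (?s xs) xs \<or> G (?s xs) xs" using ex[OF xs] by (rule LeastI_ex)
    then show "xs \<in> {xs. H (?s xs) xs} \<longleftrightarrow> xs \<in> R"
      using H(2)[OF xs] G(2)[OF xs] compl[OF xs] by blast
  qed
qed

lemma ce_rel_Un:
  assumes "ce_rel k R" "ce_rel k S"
  shows "ce_rel k (R \<union> S)"
proof -
  from assms(1) obtain H where H: "computable_rel (Suc k) {ys. H (hd ys) (tl ys)}"
    "\<And>xs. length xs = k \<Longrightarrow> xs \<in> R \<longleftrightarrow> (\<exists>s. H s xs)" by (rule ce_relE) blast
  from assms(2) obtain G where G: "computable_rel (Suc k) {ys. G (hd ys) (tl ys)}"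
    "\<And>xs. length xs = k \<Longrightarrow> xs \<in> S \<longleftrightarrow> (\<exists>s. G s xs)" by (rule ce_relE) blast
  show ?thesis
    by (rule ce_relI[of _ "\<lambda>s xs. H s xs \<or> G s xs"])
      (use H G in \<open>auto intro: computable_disj\<close>)
qed

text \<open>Monotonicity makes it enough to look for one stage at which both relations have been
  confirmed.\<close>

lemma ce_rel_Int:
  assumes "ce_rel k R" "ce_rel k S"
  shows "ce_rel k (R \<inter> S)"
proof -
  from assms(1) obtain H where H: "computable_rel (Suc k) {ys. H (hd ys) (tl ys)}"
    "\<And>xs. length xs = k \<Longrightarrow> xs \<in> R \<longleftrightarrow> (\<exists>s. H s xs)"
    "\<And>xs s t. H s xs \<Longrightarrow> s \<le> t \<Longrightarrow> H t xs" by (rule ce_relE) blast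
  from assms(2) obtain G where G: "computable_rel (Suc k) {ys. G (hd ys) (tl ys)}"
    "\<And>xs. length xs = k \<Longrightarrow> xs \<in> S \<longleftrightarrow> (\<exists>s. G s xs)"
    "\<And>xs s t. G s xs \<Longrightarrow> s \<le> t \<Longrightarrow> G t xs" by (rule ce_relE) blast
  have "(\<exists>s. H s xs) \<and> (\<exists>s. G s xs) \<longleftrightarrow> (\<exists>s. H s xs \<and> G s xs)" for xs
    using H(3) G(3) by (meson max.cobounded1 max.cobounded2)
  then show ?thesis
    by (intro ce_relI[of _ "\<lambda>s xs. H s xs \<and> G s xs"])
      (auto intro: computable_conj H(1) G(1) simp: H(2) G(2))
qed

lemma ce_rel_converse:
  assumes "ce_rel 2 R"
  shows "ce_rel 2 {xs. [xs ! 1, xs ! 0] \<in> R}"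
proof -
  from assms obtain p where p: "partial_computable 2 p"
    "\<And>xs. length xs = 2 \<Longrightarrow> xs \<in> R \<longleftrightarrow> p xs \<noteq> None" unfolding ce_rel_def by blast
  let ?qs = "[\<lambda>xs. Some (xs ! 1), \<lambda>xs. Some (xs ! 0)] :: (nat list \<Rightarrow> nat option) list"
  have "partial_computable 2
      (\<lambda>xs. if \<forall>q\<in>set ?qs. q xs \<noteq> None then p (map (\<lambda>q. the (q xs)) ?qs) else None)"
  proof (rule partial_computable_comp)
    show "partial_computable (length ?qs) p" using p(1) by (simp add: numeral_2_eq_2)
    show "partial_computable 2 q" if "q \<in> set ?qs" for q
      using that computable_nth[of 0 2] computable_nth[of 1 2] unfolding computable_fun_def by auto
  qed
  then have "partial_computable 2 (\<lambda>xs. p [xs ! 1, xs ! 0])" by simp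
  then show ?thesis unfolding ce_rel_def using p(2)
    by (intro exI[of _ "\<lambda>xs. p [xs ! 1, xs ! 0]"]) simp
qed

text \<open>Structures will be transported along partial computable bijections. On tuples these act
  coordinatewise, and the operations and relations of a structure are turned into preimages.\<close>

lemma partial_computable_nth_map:
  assumes "partial_computable_map \<phi>" "i < k"
  shows "partial_computable k (\<lambda>xs. \<phi> (xs ! i))"
  using partial_computable_comp[of "[\<lambda>xs. Some (xs ! i)]" "\<lambda>xs. \<phi> (xs ! 0)" k] assms
    computable_nth[OF assms(2)]
  by (simp add: computable_fun_def)

lemma partial_computable_map_tuple:
  assumes "partial_computable k p" "partial_computable_map \<phi>"
  shows "partial_computable k
    (\<lambda>xs. if set xs \<subseteq> dom \<phi> then p (map (\<lambda>x. the (\<phi> x)) xs) else None)"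
proof -
  let ?qs = "map (\<lambda>i xs. \<phi> (xs ! i)) [0..<k]"
  have "partial_computable k
      (\<lambda>xs. if \<forall>q\<in>set ?qs. q xs \<noteq> None then p (map (\<lambda>q. the (q xs)) ?qs) else None)"
    by (rule partial_computable_comp)
      (use assms in \<open>auto intro: partial_computable_nth_map\<close>)
  then show ?thesis
  proof (rule partial_computable_cong)
    fix xs :: "nat list" assume xs: "length xs = k"
    have "(\<forall>q\<in>set ?qs. q xs \<noteq> None) \<longleftrightarrow> set xs \<subseteq> dom \<phi>"
      using xs by (auto simp: set_conv_nth)
    moreover have "map (\<lambda>q. the (q xs)) ?qs = map (\<lambda>x. the (\<phi> x)) xs"
      using xs by (auto intro: nth_equalityI)
    ultimately show "(if \<forall>q\<in>set ?qs. q xs \<noteq> None then p (map (\<lambda>q. the (q xs)) ?qs) else None) =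
        (if set xs \<subseteq> dom \<phi> then p (map (\<lambda>x. the (\<phi> x)) xs) else None)" by (simp only:)
  qed
qed

lemma partial_computable_bind:
  assumes "partial_computable k p" "partial_computable_map \<phi>"
  shows "partial_computable k (\<lambda>xs. Option.bind (p xs) \<phi>)"
proof -
  have "partial_computable k (\<lambda>xs. if \<forall>q\<in>set [p]. q xs \<noteq> None
      then \<phi> (map (\<lambda>q. the (q xs)) [p] ! 0) else None)"
    by (rule partial_computable_comp) (use assms in auto)
  then show ?thesis by (rule partial_computable_cong) (auto simp: Option.bind_def split: option.splits)
qed

lemma ce_rel_vimage:
  assumes "ce_rel k R" "partial_computable_map \<phi>"
  shows "ce_rel k {xs. set xs \<subseteq> dom \<phi> \<and> map (\<lambda>x. the (\<phi> x)) xs \<in> R}"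
proof -
  from assms(1) obtain p where p: "partial_computable k p"
    "\<And>xs. length xs = k \<Longrightarrow> xs \<in> R \<longleftrightarrow> p xs \<noteq> None" unfolding ce_rel_def by blast
  show ?thesis
    unfolding ce_rel_def using partial_computable_map_tuple[OF p(1) assms(2)] p(2)
    by (intro exI[of _ "\<lambda>xs. if set xs \<subseteq> dom \<phi> then p (map (\<lambda>x. the (\<phi> x)) xs) else None"]) auto
qed

lemma computable_map_Some:
  "computable_map g \<Longrightarrow> partial_computable_map (\<lambda>x. Some (g x))"
  unfolding computable_fun_def .

lemma ce_set_dom: "partial_computable_map \<phi> \<Longrightarrow> ce_set (dom \<phi>)"
  unfolding ce_set_def ce_rel_def
  by (intro exI[of _ "\<lambda>xs. \<phi> (xs ! 0)"]) (auto simp: length_Suc_conv)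

section \<open>Enumeration without repetition\<close>

lemma computable_enumerate:
  assumes S: "computable_rel 1 {xs. xs ! 0 \<in> S}" and inf: "infinite S"
  shows "computable_map (enumerate S)"
proof -
  have ex: "\<exists>t. t \<in> S \<and> r < t" for r using inf by (auto simp: infinite_nat_iff_unbounded)
  have S': "computable_rel (Suc k) {ys. hd ys \<in> S}" for k
    by (intro computable_relI computable_comp1[OF computable_relD[OF S] computable_hd])
  let ?next = "\<lambda>r. LEAST t. t \<in> S \<and> r < t"
  have "computable_fun (Suc (Suc 1)) (\<lambda>ys. ?next (ys ! 1))"
    by (intro computable_Least[where P = "\<lambda>t ys. t \<in> S \<and> ys ! 1 < t"] computable_conj
        computable_less computable_hd computable_tl computable_nth S') (use ex in auto)
  then have "computable_fun 1
      (\<lambda>xs. rec_nat (LEAST t. t \<in> S) (\<lambda>m r. ?next r) (xs ! 0))"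
    by (intro computable_rec_nat computable_const computable_nth) auto
  moreover have "rec_nat (LEAST t. t \<in> S) (\<lambda>m r. ?next r) n = enumerate S n" for n
    by (induction n) (auto simp: enumerate_0 enumerate_Suc''[OF inf])
  ultimately show ?thesis by simp
qed

text \<open>
  Every stage \<open>t\<close> of the search is read as \<open>t = q\<^sup>2 + x\<close> with \<open>x \<le> 2 q\<close>, and tests whether \<open>x\<close> has
  entered the set by stage \<open>q\<close>. Monotonicity in \<open>q\<close> makes up for the fact that a given \<open>x\<close> is only
  paired with the \<open>q \<ge> x / 2\<close>, so that this replaces a pairing function.
\<close>

definition sqrt_rest :: "nat \<Rightarrow> nat" where
  "sqrt_rest t = t - (floor_sqrt t)\<^sup>2"

lemma computable_floor_sqrt: "computable_map floor_sqrt"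
proof -
  have floor_sqrt: "(LEAST q. t < (q + 1) * (q + 1)) = floor_sqrt t" for t
  proof (rule Least_equality)
    show "t < (floor_sqrt t + 1) * (floor_sqrt t + 1)"
      using Suc_floor_sqrt_power2_gt[of t] by (simp add: power2_eq_square)
    show "floor_sqrt t \<le> q" if "t < (q + 1) * (q + 1)" for q
      using that le_floor_sqrt_iff[of "Suc q" t] by (simp add: power2_eq_square not_le)
  qed
  have "\<exists>q. t < (q + 1) * (q + 1)" for t :: nat by (rule exI[of _ t]) simp
  then have "computable_map (\<lambda>t. LEAST q. t < (q + 1) * (q + 1))"
    by (intro computable_Least computable_less computable_mult computable_add computable_const
        computable_hd computable_tl computable_nth) auto
  then show ?thesis unfolding floor_sqrt .
qed

lemma computable_sqrt_rest: "computable_map sqrt_rest"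
  unfolding sqrt_rest_def power2_eq_square
  by (intro computable_diff computable_mult computable_floor_sqrt computable_nth) simp

lemma floor_sqrt_square_add: "x \<le> 2 * q \<Longrightarrow> floor_sqrt (q\<^sup>2 + x) = q"
  by (rule floor_sqrt_unique) (auto simp: power2_eq_square)

lemma sqrt_rest_square_add: "x \<le> 2 * q \<Longrightarrow> sqrt_rest (q\<^sup>2 + x) = x"
  unfolding sqrt_rest_def by (simp add: floor_sqrt_square_add)

text \<open>An element is enumerated at the first stage that finds it; these stages form an infinite
  computable set, whose increasing enumeration is therefore computable.\<close>

lemma ce_set_enumeration:
  assumes ce: "ce_set D" and inf: "infinite D"
  obtains g where "computable_map g" "bij_betw g UNIV D"
proof -
  from ce[unfolded ce_set_def] obtain H where
    H: "computable_rel (Suc 1) {ys. H (hd ys) (tl ys)}"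
    and iff: "\<And>xs. length xs = 1 \<Longrightarrow> xs \<in> {[x] | x. x \<in> D} \<longleftrightarrow> (\<exists>s. H s xs)"
    and mono: "\<And>xs s t. H s xs \<Longrightarrow> s \<le> t \<Longrightarrow> H t xs"
    by (rule ce_relE) blast
  have D: "x \<in> D \<longleftrightarrow> (\<exists>s. H s [x])" for x using iff[of "[x]"] by simp
  define found where "found t \<longleftrightarrow> H (floor_sqrt t) [sqrt_rest t]" for t
  define S where "S = {t. found t \<and> (\<forall>u<t. \<not> (found u \<and> sqrt_rest u = sqrt_rest t))}"
  have found: "computable_rel k {xs. found (f xs)}" if f: "computable_fun k f" for k f
  proof -
    have "computable_fun 1
        (\<lambda>xs. of_bool (H (floor_sqrt (xs ! 0)) (map (\<lambda>h. h xs) [\<lambda>xs. sqrt_rest (xs ! 0)])))"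
      by (rule computable_comp_list[where F = "\<lambda>s xs. of_bool (H s xs)"])
        (use computable_relD[OF H] computable_floor_sqrt computable_sqrt_rest in auto)
    then have "computable_fun 1 (\<lambda>xs. of_bool (found (xs ! 0)))" by (simp add: found_def)
    from computable_relI[OF computable_comp1[OF this f]] show ?thesis .
  qed
  have x: "computable_map (\<lambda>x. x)" by (rule computable_nth) simp
  have "computable_rel (Suc 1)
      {ys. \<not> (found (hd ys) \<and> sqrt_rest (hd ys) = sqrt_rest (tl ys ! 0))}"
    by (intro computable_Not computable_conj found computable_eq
        computable_comp1[OF computable_sqrt_rest] computable_hd computable_tl x)
  from computable_ball_less[where P = "\<lambda>u xs. \<not> (found u \<and> sqrt_rest u = sqrt_rest (xs ! 0))",
      OF this x]
  have "computable_rel 1 {xs. \<forall>u<xs ! 0. \<not> (found u \<and> sqrt_rest u = sqrt_rest (xs ! 0))}" .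
  from computable_conj[OF found[OF x] this]
  have "computable_rel 1 {xs. xs ! 0 \<in> S}"
    unfolding S_def mem_Collect_eq .
  moreover have bij: "bij_betw sqrt_rest S D"
    unfolding bij_betw_def
  proof
    show "inj_on sqrt_rest S"
    proof (rule linorder_inj_onI)
      show "sqrt_rest t \<noteq> sqrt_rest u" if "t < u" "t \<in> S" "u \<in> S" for t u
        using that unfolding S_def by simp
    qed auto
    show "sqrt_rest ` S = D"
    proof
      show "sqrt_rest ` S \<subseteq> D" by (auto simp: S_def found_def D)
      show "D \<subseteq> sqrt_rest ` S"
      proof
        fix x assume "x \<in> D"
        then obtain s where "H s [x]" unfolding D ..
        then have "H (max s x) [x]" by (rule mono) simp
        then have "\<exists>t. found t \<and> sqrt_rest t = x"
          by (intro exI[of _ "(max s x)\<^sup>2 + x"])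
            (simp add: found_def floor_sqrt_square_add sqrt_rest_square_add)
        from exists_least_iff[THEN iffD1, OF this] show "x \<in> sqrt_rest ` S"
          unfolding S_def by auto
      qed
    qed
  qed
  moreover have infS: "infinite S" using inf bij_betw_finite[OF bij] by simp
  ultimately have "computable_map (\<lambda>n. sqrt_rest (enumerate S n))"
    by (intro computable_comp1[OF computable_sqrt_rest] computable_enumerate)
  moreover have "bij_betw (\<lambda>n. sqrt_rest (enumerate S n)) UNIV D"
    using bij_betw_trans[OF bij_enumerate[OF infS] bij] by (simp add: comp_def)
  ultimately show thesis by (rule that)
qed

lemma partial_computable_inverse:
  assumes g: "computable_map g" and inj: "inj g"
  obtains \<phi> where "partial_computable_map \<phi>" "dom \<phi> = range g" "\<And>n. \<phi> (g n) = Some n"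
proof -
  let ?\<phi> = "\<lambda>x. if \<exists>n. g n = x then Some (LEAST n. g n = x) else None"
  have "partial_computable 1 (\<lambda>xs. if \<exists>n. g n = xs ! 0 then Some (LEAST n. g n = xs ! 0) else None)"
    by (intro computable_partial_Least computable_eq computable_comp1[OF g] computable_hd
        computable_tl computable_nth) simp
  moreover have "dom ?\<phi> = range g" by (auto split: if_splits)
  moreover have "?\<phi> (g n) = Some n" for n
    by (auto simp: inj_eq[OF inj] intro!: Least_equality)
  ultimately show thesis by (rule that[of ?\<phi>])
qed

section \<open>Isomorphisms\<close>

text \<open>The map is a parameter because isomorphisms have to be restricted, inverted and required to be
  computable.\<close>

definition iso_via ::
  "('f, 'r) language \<Rightarrow> (nat \<Rightarrow> nat) \<Rightarrow> ('f, 'r) struct \<Rightarrow> ('f, 'r) struct \<Rightarrow> bool" where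
  "iso_via L h M N \<longleftrightarrow> bij_betw h (universe M) (universe N) \<and>
     (\<forall>f\<in>fsyms L. \<forall>xs\<in>tuples (farity L f) (universe M).
        h (func M f xs) = func N f (map h xs)) \<and>
     (\<forall>r\<in>rsyms L. \<forall>xs\<in>tuples (rarity L r) (universe M).
        xs \<in> rel M r \<longleftrightarrow> map h xs \<in> rel N r)"

lemma isomorphic_iff_iso_via: "isomorphic L M N \<longleftrightarrow> (\<exists>h. iso_via L h M N)"
  unfolding isomorphic_def iso_via_def ..

lemma iso_via_bij: "iso_via L h M N \<Longrightarrow> bij_betw h (universe M) (universe N)"
  unfolding iso_via_def by blast

lemma iso_via_func:
  "iso_via L h M N \<Longrightarrow> f \<in> fsyms L \<Longrightarrow> xs \<in> tuples (farity L f) (universe M) \<Longrightarrow>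
    h (func M f xs) = func N f (map h xs)"
  unfolding iso_via_def by blast

lemma iso_via_rel:
  "iso_via L h M N \<Longrightarrow> r \<in> rsyms L \<Longrightarrow> xs \<in> tuples (rarity L r) (universe M) \<Longrightarrow>
    map h xs \<in> rel N r \<longleftrightarrow> xs \<in> rel M r"
  unfolding iso_via_def by blast

lemma is_struct_func:
  "is_struct L M \<Longrightarrow> f \<in> fsyms L \<Longrightarrow> xs \<in> tuples (farity L f) (universe M) \<Longrightarrow>
    func M f xs \<in> universe M"
  unfolding is_struct_def by blast

lemma map_in_tuples:
  "xs \<in> tuples k U \<Longrightarrow> (\<And>x. x \<in> U \<Longrightarrow> h x \<in> V) \<Longrightarrow> map h xs \<in> tuples k V"
  unfolding tuples_def by auto

lemma tuples_imageE:
  assumes "ys \<in> tuples k (h ` U)"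
  obtains xs where "xs \<in> tuples k U" "ys = map h xs"
proof -
  from assms have "length ys = k" "\<forall>y\<in>set ys. \<exists>x. x \<in> U \<and> y = h x" unfolding tuples_def by auto
  from bchoice[OF this(2)] obtain c where "\<forall>y\<in>set ys. c y \<in> U \<and> y = h (c y)" by blast
  then have "map c ys \<in> tuples k U" "ys = map h (map c ys)"
    using \<open>length ys = k\<close> unfolding tuples_def by (auto simp: map_idI)
  then show thesis by (rule that)
qed

lemma iso_via_is_struct:
  assumes M: "is_struct L M" and iso: "iso_via L h M N"
  shows "is_struct L N"
  unfolding is_struct_def
proof (intro conjI ballI)
  have N: "universe N = h ` universe M" using iso_via_bij[OF iso] by (simp add: bij_betw_def)
  then show "universe N \<noteq> {}" using M unfolding is_struct_def by simp
  fix f ys assume f: "f \<in> fsyms L" and ys: "ys \<in> tuples (farity L f) (universe N)"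
  from ys obtain xs where xs: "xs \<in> tuples (farity L f) (universe M)" "ys = map h xs"
    unfolding N by (rule tuples_imageE)
  show "func N f ys \<in> universe N"
    using iso_via_func[OF iso f xs(1)] is_struct_func[OF M f xs(1)] unfolding xs(2) N by force
qed

lemma iso_via_inverse:
  assumes M: "is_struct L M" and iso: "iso_via L h M N"
    and inv: "\<And>x. x \<in> universe M \<Longrightarrow> h' (h x) = x"
  shows "iso_via L h' N M"
  unfolding iso_via_def
proof (intro conjI ballI)
  have N: "universe N = h ` universe M" using iso_via_bij[OF iso] by (simp add: bij_betw_def)
  show "bij_betw h' (universe N) (universe M)"
    unfolding N by (rule bij_betw_byWitness[of _ h]) (auto simp: inv)
  have map: "map h' (map h xs) = xs" if "xs \<in> tuples k (universe M)" for xs k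
    using that inv unfolding tuples_def map_map by (intro map_idI) auto
  show "h' (func N f ys) = func M f (map h' ys)"
    if f: "f \<in> fsyms L" and ys: "ys \<in> tuples (farity L f) (universe N)" for f ys
  proof -
    from ys obtain xs where xs: "xs \<in> tuples (farity L f) (universe M)" "ys = map h xs"
      unfolding N by (rule tuples_imageE)
    show ?thesis
      using inv[OF is_struct_func[OF M f xs(1)]] iso_via_func[OF iso f xs(1)] map[OF xs(1)]
      unfolding xs(2) by metis
  qed
  show "ys \<in> rel N r \<longleftrightarrow> map h' ys \<in> rel M r"
    if r: "r \<in> rsyms L" and ys: "ys \<in> tuples (rarity L r) (universe N)" for r ys
  proof -
    from ys obtain xs where xs: "xs \<in> tuples (rarity L r) (universe M)" "ys = map h xs"
      unfolding N by (rule tuples_imageE)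
    show ?thesis using iso_via_rel[OF iso r xs(1)] map[OF xs(1)] unfolding xs(2) by metis
  qed
qed

lemma iso_via_trans:
  assumes "iso_via L h M N" "iso_via L k N P"
  shows "iso_via L (k \<circ> h) M P"
proof -
  have map: "map h xs \<in> tuples j (universe N)" if "xs \<in> tuples j (universe M)" for xs j
    using that by (rule map_in_tuples) (use iso_via_bij[OF assms(1)] in \<open>auto simp: bij_betw_def\<close>)
  show ?thesis
    unfolding iso_via_def
    using bij_betw_trans[OF iso_via_bij[OF assms(1)] iso_via_bij[OF assms(2)]]
    by (auto simp: iso_via_func[OF assms(1), symmetric] iso_via_func[OF assms(2)] map
        iso_via_rel[OF assms(1)] iso_via_rel[OF assms(2)] simp flip: map_map)
       (simp add: iso_via_func[OF assms(1)] iso_via_func[OF assms(2)] map)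
qed

lemma isomorphic_sym: "is_struct L M \<Longrightarrow> isomorphic L M N \<Longrightarrow> isomorphic L N M"
  unfolding isomorphic_iff_iso_via
  using iso_via_inverse iso_via_bij by (metis bij_betw_inv_into_left)

lemma isomorphic_trans: "isomorphic L M N \<Longrightarrow> isomorphic L N P \<Longrightarrow> isomorphic L M P"
  unfolding isomorphic_iff_iso_via using iso_via_trans by blast

text \<open>The inverse \<open>h'\<close> of \<open>h\<close> is a parameter so that it can be given by a computable function on all
  numbers.\<close>

definition transport ::
  "(nat \<Rightarrow> nat) \<Rightarrow> (nat \<Rightarrow> nat) \<Rightarrow> nat set \<Rightarrow> ('f, 'r) struct \<Rightarrow> ('f, 'r) struct" where
  "transport h h' U M = \<lparr>universe = U,
     func = (\<lambda>f ys. h (func M f (map h' ys))),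
     rel = (\<lambda>r. {ys. map h' ys \<in> rel M r})\<rparr>"

lemma iso_via_transport:
  assumes "bij_betw h (universe M) U" "\<And>x. x \<in> universe M \<Longrightarrow> h' (h x) = x"
  shows "iso_via L h M (transport h h' U M)"
proof -
  have "map h' (map h xs) = xs" if "xs \<in> tuples k (universe M)" for xs k
    using that assms(2) unfolding tuples_def map_map by (intro map_idI) auto
  with assms(1) show ?thesis
    unfolding iso_via_def transport_def by (simp del: map_map)
qed

lemma substructure_is_struct: "substructure L B A \<Longrightarrow> is_struct L B"
  unfolding substructure_def by blast

lemma substructure_image:
  assumes iso: "iso_via L h M A" and B: "substructure L B M"
  defines "B' \<equiv> A\<lparr>universe := h ` universe B\<rparr>"
  shows "substructure L B' A" "iso_via L h B B'"
proof -
  have sub: "universe B \<subseteq> universe M" using B unfolding substructure_def by blast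
  have tup: "xs \<in> tuples k (universe M)" if "xs \<in> tuples k (universe B)" for xs k
    using that sub unfolding tuples_def by blast
  show iso': "iso_via L h B B'"
    unfolding iso_via_def
  proof (intro conjI ballI)
    show "bij_betw h (universe B) (universe B')"
      using iso_via_bij[OF iso] sub unfolding B'_def bij_betw_def by (auto intro: inj_on_subset)
  next
    fix f xs assume "f \<in> fsyms L" "xs \<in> tuples (farity L f) (universe B)"
    then show "h (func B f xs) = func B' f (map h xs)"
      using B iso_via_func[OF iso _ tup] unfolding substructure_def B'_def by simp
  next
    fix r xs assume "r \<in> rsyms L" "xs \<in> tuples (rarity L r) (universe B)"
    then show "xs \<in> rel B r \<longleftrightarrow> map h xs \<in> rel B' r"
      using B iso_via_rel[OF iso _ tup] unfolding substructure_def B'_def by simp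
  qed
  have "universe B' \<subseteq> universe A"
    using sub iso_via_bij[OF iso] unfolding B'_def bij_betw_def by auto
  then show "substructure L B' A"
    using iso_via_is_struct[OF substructure_is_struct[OF B] iso']
    unfolding substructure_def B'_def by simp
qed

section \<open>Invariance of truth under isomorphisms\<close>

lemma teval_iso:
  assumes M: "is_struct L M" and iso: "iso_via L h M N" and e: "range e \<subseteq> universe M"
  shows "wf_trm L t \<Longrightarrow> teval M e t \<in> universe M \<and> h (teval M e t) = teval N (h \<circ> e) t"
proof (induction t)
  case (Var x)
  then show ?case using e by auto
next
  case (App f ts)
  then have f: "f \<in> fsyms L" and ts: "map (teval M e) ts \<in> tuples (farity L f) (universe M)"
    by (auto simp: tuples_def list_all_iff)
  have "map h (map (teval M e) ts) = map (teval N (h \<circ> e)) ts"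
    using App by (auto simp: list_all_iff comp_def)
  then show ?case
    using is_struct_func[OF M f ts] iso_via_func[OF iso f ts] by (simp del: map_map add: comp_def)
qed

lemma sat_foldr_iso:
  assumes U: "h ` universe M = universe N"
    and \<psi>: "\<And>e. range e \<subseteq> universe M \<Longrightarrow> sat M \<psi> e \<longleftrightarrow> sat N \<psi> (h \<circ> e)"
    and e: "range e \<subseteq> universe M"
  shows "sat M (foldr Ex xs \<psi>) e \<longleftrightarrow> sat N (foldr Ex xs \<psi>) (h \<circ> e)"
    and "sat M (foldr All xs \<psi>) e \<longleftrightarrow> sat N (foldr All xs \<psi>) (h \<circ> e)"
proof -
  have upd: "range (e(x := a)) \<subseteq> universe M" if "range e \<subseteq> universe M" "a \<in> universe M" for e x a
    using that by auto
  show "sat M (foldr Ex xs \<psi>) e \<longleftrightarrow> sat N (foldr Ex xs \<psi>) (h \<circ> e)"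
    using e
  proof (induction xs arbitrary: e)
    case (Cons x xs)
    have "sat M (foldr Ex xs \<psi>) (e(x := a)) \<longleftrightarrow> sat N (foldr Ex xs \<psi>) ((h \<circ> e)(x := h a))"
      if "a \<in> universe M" for a
      using Cons.IH[OF upd[OF Cons.prems that]] by (simp only: fun_upd_comp)
    then show ?case by (simp add: comp_def flip: U)
  qed (simp add: \<psi>)
  show "sat M (foldr All xs \<psi>) e \<longleftrightarrow> sat N (foldr All xs \<psi>) (h \<circ> e)"
    using e
  proof (induction xs arbitrary: e)
    case (Cons x xs)
    have "sat M (foldr All xs \<psi>) (e(x := a)) \<longleftrightarrow> sat N (foldr All xs \<psi>) ((h \<circ> e)(x := h a))"
      if "a \<in> universe M" for a
      using Cons.IH[OF upd[OF Cons.prems that]] by (simp only: fun_upd_comp)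
    then show ?case by (simp add: comp_def flip: U)
  qed (simp add: \<psi>)
qed

lemma sat_qf_iso:
  assumes M: "is_struct L M" and iso: "iso_via L h M N" and e: "range e \<subseteq> universe M"
  shows "qf_fm L \<phi> \<Longrightarrow> sat M \<phi> e \<longleftrightarrow> sat N \<phi> (h \<circ> e)"
proof (induction rule: qf_fm.induct)
  case (1 s t)
  have "inj_on h (universe M)" using iso_via_bij[OF iso] by (simp add: bij_betw_def)
  with 1 show ?case using teval_iso[OF M iso e] by (metis inj_on_eq_iff sat.simps(1))
next
  case (2 r ts)
  have ts: "map (teval M e) ts \<in> tuples (rarity L r) (universe M)"
    using 2 teval_iso[OF M iso e] unfolding tuples_def by auto
  have "map h (map (teval M e) ts) = map (teval N (h \<circ> e)) ts"
    using 2 teval_iso[OF M iso e] by auto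
  then show ?case using iso_via_rel[OF iso 2(1) ts] by (simp del: map_map add: comp_def)
qed (auto simp: cimage.rep_eq)

lemma sat_Sigma_iso:
  assumes M: "is_struct L M" and iso: "iso_via L h M N" and e: "range e \<subseteq> universe M"
    and \<phi>: "Sigma_fm L n \<phi>"
  shows "sat M \<phi> e \<longleftrightarrow> sat N \<phi> (h \<circ> e)"
proof -
  have U: "h ` universe M = universe N" using iso_via_bij[OF iso] by (simp add: bij_betw_def)
  have "(Sigma_fm L n \<phi> \<longrightarrow> (\<forall>e. range e \<subseteq> universe M \<longrightarrow> sat M \<phi> e = sat N \<phi> (h \<circ> e))) \<and>
        (Pi_fm L n \<phi> \<longrightarrow> (\<forall>e. range e \<subseteq> universe M \<longrightarrow> sat M \<phi> e = sat N \<phi> (h \<circ> e)))"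
  proof (induction rule: Sigma_fm_Pi_fm.induct)
    case (3 n F)
    have "sat M \<phi> e = sat N \<phi> (h \<circ> e)"
      if \<phi>: "\<phi> \<in> rcset F" and e: "range e \<subseteq> universe M" for \<phi> e
    proof -
      from 3(2) \<phi> obtain xs \<psi> where \<psi>: "\<phi> = foldr Ex xs \<psi>"
        "\<And>e. range e \<subseteq> universe M \<Longrightarrow> sat M \<psi> e = sat N \<psi> (h \<circ> e)" by blast
      show ?thesis unfolding \<psi>(1) by (rule sat_foldr_iso(1)[OF U \<psi>(2) e])
    qed
    then show ?case by (simp add: cimage.rep_eq comp_def)
  next
    case (4 n F)
    have "sat M \<phi> e = sat N \<phi> (h \<circ> e)"
      if \<phi>: "\<phi> \<in> rcset F" and e: "range e \<subseteq> universe M" for \<phi> e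
    proof -
      from 4(2) \<phi> obtain xs \<psi> where \<psi>: "\<phi> = foldr All xs \<psi>"
        "\<And>e. range e \<subseteq> universe M \<Longrightarrow> sat M \<psi> e = sat N \<psi> (h \<circ> e)" by blast
      show ?thesis unfolding \<psi>(1) by (rule sat_foldr_iso(2)[OF U \<psi>(2) e])
    qed
    then show ?case by (simp add: cimage.rep_eq comp_def)
  qed (use sat_qf_iso[OF M iso] in blast)+
  with \<phi> e show ?thesis by blast
qed

text \<open>Parameters from the image are pulled back along \<open>h\<close>; truth in the large and in the small structure
  is then compared on the side where elementarity is known.\<close>

lemma Sigma_elementary_substructure_image:
  assumes M: "is_struct L M" and iso: "iso_via L h M A"
    and B: "Sigma_elementary_substructure n L B M"
  shows "Sigma_elementary_substructure n L (A\<lparr>universe := h ` universe B\<rparr>) A"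
proof -
  let ?B' = "A\<lparr>universe := h ` universe B\<rparr>"
  from B have sub: "substructure L B M" unfolding Sigma_elementary_substructure_def by blast
  note img = substructure_image[OF iso sub]
  have "sat ?B' \<phi> b \<longleftrightarrow> sat A \<phi> b"
    if \<phi>: "Sigma_fm L n \<phi>" "finite (fvars \<phi>)" and b: "range b \<subseteq> universe ?B'" for \<phi> b
  proof -
    define c where "c = inv_into (universe B) h \<circ> b"
    have bx: "b x \<in> h ` universe B" for x using b by auto
    have c: "range c \<subseteq> universe B" using inv_into_into[OF bx] unfolding c_def by auto
    have hc: "h \<circ> c = b" using f_inv_into_f[OF bx] unfolding c_def by auto
    have "range c \<subseteq> universe M" using c sub unfolding substructure_def by blast
    then have "sat A \<phi> b \<longleftrightarrow> sat M \<phi> c" using sat_Sigma_iso[OF M iso _ \<phi>(1)] hc by metis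
    also have "\<dots> \<longleftrightarrow> sat B \<phi> c"
      using B \<phi> c unfolding Sigma_elementary_substructure_def by blast
    also have "\<dots> \<longleftrightarrow> sat ?B' \<phi> b"
      using sat_Sigma_iso[OF substructure_is_struct[OF sub] img(2) c \<phi>(1)] hc by metis
    finally show ?thesis ..
  qed
  with img(1) show ?thesis unfolding Sigma_elementary_substructure_def by blast
qed

section \<open>Dense sets\<close>

lemma denseI:
  assumes "(\<lambda>n. real (card (- D \<inter> {0..n})) / real (n + 1)) \<longlonglongrightarrow> 0"
  shows "dense D"
proof -
  have "real (card (D \<inter> {0..n})) / real (n + 1) = 1 - real (card (- D \<inter> {0..n})) / real (n + 1)"
    for n
  proof -
    have "{0..n} = D \<inter> {0..n} \<union> - D \<inter> {0..n}" by blast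
    then have "card {0..n} = card (D \<inter> {0..n} \<union> - D \<inter> {0..n})" by simp
    also have "\<dots> = card (D \<inter> {0..n}) + card (- D \<inter> {0..n})" by (rule card_Un_disjoint) auto
    finally have "real (card (D \<inter> {0..n})) = real (n + 1) - real (card (- D \<inter> {0..n}))" by simp
    then show ?thesis by (simp add: diff_divide_distrib del: of_nat_Suc)
  qed
  moreover have "(\<lambda>n. 1 - real (card (- D \<inter> {0..n})) / real (n + 1)) \<longlonglongrightarrow> 1 - 0"
    by (intro tendsto_diff tendsto_const assms)
  ultimately show ?thesis unfolding dense_def by simp
qed

lemma finite_density_zero:
  assumes "finite X"
  shows "(\<lambda>n. real (card (X \<inter> {0..n})) / real (n + 1)) \<longlonglongrightarrow> 0"
proof (rule tendsto_sandwich[OF _ _ tendsto_const])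
  show "(\<lambda>n. real (card X) * inverse (real (Suc n))) \<longlonglongrightarrow> 0"
    using tendsto_mult[OF tendsto_const LIMSEQ_inverse_real_of_nat] by simp
  show "\<forall>\<^sub>F n in sequentially. real (card (X \<inter> {0..n})) / real (n + 1) \<le>
      real (card X) * inverse (real (Suc n))"
    using card_mono[OF assms, of "X \<inter> {0..n}" for n]
    by (intro always_eventually allI) (simp add: divide_inverse mult_right_mono del: of_nat_Suc)
qed simp

lemma dense_infinite: "dense D \<Longrightarrow> infinite D"
  using finite_density_zero[of D] LIMSEQ_unique unfolding dense_def by fastforce

text \<open>There are at most \<open>sqrt n + 1\<close> squares up to \<open>n\<close>.\<close>

lemma dense_nonsquares: "dense {t. sqrt_rest t \<noteq> 0}"
proof (rule denseI, rule tendsto_sandwich[OF _ _ tendsto_const])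
  have "(\<lambda>n. 2 * sqrt (inverse (real (Suc n)))) \<longlonglongrightarrow> 2 * sqrt 0"
    by (intro tendsto_mult tendsto_const tendsto_real_sqrt LIMSEQ_inverse_real_of_nat)
  then show "(\<lambda>n. 2 * sqrt (inverse (real (Suc n)))) \<longlonglongrightarrow> 0" by simp
  have "real (card (- {t. sqrt_rest t \<noteq> 0} \<inter> {0..n})) / real (n + 1) \<le>
      2 * sqrt (inverse (real (Suc n)))" for n
  proof -
    let ?S = "- {t. sqrt_rest t \<noteq> 0} \<inter> {0..n}"
    have square: "t = (floor_sqrt t)\<^sup>2" if "t \<in> ?S" for t
      using that floor_sqrt_power2_le[of t] unfolding sqrt_rest_def by simp
    have inj: "inj_on floor_sqrt ?S"
      by (rule inj_on_inverseI[of _ "\<lambda>q. q\<^sup>2"], rule square[symmetric])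
    have "floor_sqrt ` ?S \<subseteq> {..floor_sqrt n}" by (auto intro: mono_floor_sqrt')
    from card_inj_on_le[OF inj this] have "card ?S \<le> floor_sqrt n + 1" by simp
    moreover have "real (floor_sqrt n) \<le> sqrt (real n)"
      using floor_sqrt_power2_le[of n] by (intro real_le_rsqrt) (simp flip: of_nat_power)
    ultimately have "real (card ?S) \<le> sqrt (real n) + 1" by linarith
    also have "\<dots> \<le> 2 * sqrt (real (Suc n))"
    proof -
      have "sqrt (real n) \<le> sqrt (real (Suc n))" "1 \<le> sqrt (real (Suc n))" by simp_all
      then show ?thesis by linarith
    qed
    finally have "real (card ?S) / real (n + 1) \<le> 2 * sqrt (real (Suc n)) / real (Suc n)"
      by (simp add: divide_right_mono del: of_nat_Suc)
    also have "\<dots> = 2 * sqrt (inverse (real (Suc n)))"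
      by (simp only: real_sqrt_inverse sqrt_divide_self_eq[OF of_nat_0_le_iff]
          flip: times_divide_eq_right)
    finally show ?thesis .
  qed
  then show "\<forall>\<^sub>F n in sequentially. real (card (- {t. sqrt_rest t \<noteq> 0} \<inter> {0..n})) / real (n + 1) \<le>
      2 * sqrt (inverse (real (Suc n)))" by (rule always_eventually[OF allI])
qed simp

lemma infinite_squares: "infinite {t. sqrt_rest t = 0}"
proof
  assume "finite {t. sqrt_rest t = 0}"
  moreover have "range (\<lambda>q. q\<^sup>2) \<subseteq> {t. sqrt_rest t = 0}"
    using sqrt_rest_square_add[of 0] by auto
  moreover have "inj (\<lambda>q :: nat. q\<^sup>2)" by (auto intro!: injI)
  ultimately show False using finite_imageD finite_subset infinite_UNIV_nat by blast
qed

lemma ce_set_computable: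
  assumes "computable_rel 1 {xs. xs ! 0 \<in> D}"
  shows "ce_set D"
  unfolding ce_set_def
  by (rule ce_rel_cong[OF computable_imp_ce_rel[OF assms]]) (auto simp: length_Suc_conv)

text \<open>A final segment of the natural numbers serves a finite \<open>Y\<close>, and the set of nonsquares serves an
  infinite one.\<close>

lemma dense_ce_set_with_complement:
  fixes Y :: "nat set"
  obtains D \<rho> where "dense D" "ce_set D" "bij_betw \<rho> Y (- D)"
proof (cases "finite Y")
  case True
  let ?D = "{card Y..}"
  have compl: "- ?D = {..<card Y}" by auto
  have "finite (- ?D)" unfolding compl by simp
  then have "dense ?D" by (intro denseI finite_density_zero)
  moreover have "ce_set ?D"
    by (rule ce_set_computable) (simp add: computable_le computable_const computable_nth)
  moreover have "\<exists>\<rho>. bij_betw \<rho> Y (- ?D)"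
    using True unfolding compl by (intro finite_same_card_bij) auto
  ultimately show thesis using that by blast
next
  case False
  let ?D = "{t. sqrt_rest t \<noteq> 0}"
  have compl: "- ?D = {t. sqrt_rest t = 0}" by auto
  have "ce_set ?D"
    by (rule ce_set_computable, unfold mem_Collect_eq)
      (intro computable_Not computable_eq computable_sqrt_rest computable_const)
  moreover have "bij_betw (enumerate (- ?D) \<circ> inv (enumerate Y)) Y (- ?D)"
    using bij_betw_trans[OF bij_betw_inv_into[OF bij_enumerate[OF False]]
        bij_enumerate[OF infinite_squares]]
    unfolding compl .
  ultimately show thesis using that dense_nonsquares by blast
qed

text \<open>An infinite set \<open>X\<close>, given with any enumeration \<open>\<kappa>\<close>, can be moved by a permutation of the
  natural numbers onto a dense set on which \<open>\<kappa>\<close> becomes a computable enumeration. Nothing effective is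
  asked of the permutation outside \<open>X\<close>; only the cardinality of the complement has to be right.\<close>

lemma move_to_dense_set:
  assumes \<kappa>: "bij_betw \<kappa> UNIV (X :: nat set)"
  obtains \<tau> g where "bij \<tau>" "computable_map g" "bij_betw g UNIV (\<tau> ` X)" "dense (\<tau> ` X)"
    "\<tau> \<circ> \<kappa> = g"
proof -
  obtain D \<rho> where D: "dense D" "ce_set D" and \<rho>: "bij_betw \<rho> (- X) (- D)"
    by (rule dense_ce_set_with_complement)
  from D(2) dense_infinite[OF D(1)] obtain g where g: "computable_map g" "bij_betw g UNIV D"
    by (rule ce_set_enumeration)
  \<comment> \<open>\<open>\<tau>\<close> follows \<open>\<kappa>\<close> backwards and \<open>g\<close> forwards on \<open>X\<close>, which forces \<open>\<tau> \<circ> \<kappa> = g\<close>.\<close>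
  let ?\<tau> = "\<lambda>x. if x \<in> X then g (inv \<kappa> x) else \<rho> x"
  have "bij_betw (\<lambda>x. g (inv \<kappa> x)) X D"
    using bij_betw_trans[OF bij_betw_inv_into[OF \<kappa>] g(2)] by (simp add: comp_def)
  then have X: "bij_betw ?\<tau> X D" by (rule bij_betw_cong[THEN iffD1, rotated]) simp
  have "bij_betw ?\<tau> (- X) (- D)" by (rule bij_betw_cong[THEN iffD1, OF _ \<rho>]) simp
  from bij_betw_combine[OF X this] have "bij ?\<tau>" by simp
  moreover have "?\<tau> ` X = D" using X by (simp only: bij_betw_def)
  moreover have "?\<tau> \<circ> \<kappa> = g"
  proof
    show "(?\<tau> \<circ> \<kappa>) n = g n" for n
      using \<kappa> bij_betw_imp_inj_on[OF \<kappa>] by (auto simp: bij_betw_def)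
  qed
  ultimately show thesis using that[of ?\<tau> g] D(1) g by metis
qed

section \<open>Effective structures\<close>

text \<open>An isomorphism computable in the direction \<open>N \<rightarrow> M\<close> pulls the enumerations of \<open>M\<close> back to \<open>N\<close>.
  It must be undefined outside \<open>N\<close> for the universe of \<open>N\<close> to be c.e.\<close>

lemma ce_struct_pullback:
  assumes M: "ce_struct L M" and \<phi>: "partial_computable_map \<phi>" "dom \<phi> = universe N"
    and iso: "iso_via L (\<lambda>x. the (\<phi> x)) N M" and N: "is_struct L N" "infinite (universe N)"
  shows "ce_struct L N"
  unfolding ce_struct_def
proof (intro conjI ballI)
  let ?h = "\<lambda>x. the (\<phi> x)"
  show "is_struct L N" "infinite (universe N)" by (fact N)+
  show "ce_set (universe N)" using ce_set_dom[OF \<phi>(1)] \<phi>(2) by simp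
  have bij: "bij_betw ?h (universe N) (universe M)" by (rule iso_via_bij[OF iso])
  have tup: "map ?h xs \<in> tuples k (universe M)" if "xs \<in> tuples k (universe N)" for xs k
    using that by (rule map_in_tuples) (use bij in \<open>auto simp: bij_betw_def\<close>)
  show "ce_rel (Suc (farity L f)) {xs @ [func N f xs] | xs. xs \<in> tuples (farity L f) (universe N)}"
    if f: "f \<in> fsyms L" for f
  proof (rule ce_rel_cong)
    let ?k = "farity L f"
    let ?G = "{xs @ [func M f xs] | xs. xs \<in> tuples ?k (universe M)}"
    have "ce_rel (Suc ?k) ?G" using M f unfolding ce_struct_def by blast
    from ce_rel_vimage[OF this \<phi>(1)]
    show "ce_rel (Suc ?k) {zs. set zs \<subseteq> dom \<phi> \<and> map ?h zs \<in> ?G}" .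
    fix zs :: "nat list" assume "length zs = Suc ?k"
    then obtain xs y where zs: "zs = xs @ [y]" "length xs = ?k"
      by (metis length_Suc_conv_rev)
    show "zs \<in> {zs. set zs \<subseteq> dom \<phi> \<and> map ?h zs \<in> ?G} \<longleftrightarrow>
        zs \<in> {xs @ [func N f xs] | xs. xs \<in> tuples ?k (universe N)}"
    proof (cases "xs \<in> tuples ?k (universe N)")
      case True
      have "func M f (map ?h xs) = ?h (func N f xs)" using iso_via_func[OF iso f True] ..
      moreover have "func N f xs \<in> universe N" by (rule is_struct_func[OF N(1) f True])
      moreover have "?h y = ?h y' \<longleftrightarrow> y = y'" if "y \<in> universe N" "y' \<in> universe N" for y'
        using that bij unfolding bij_betw_def by (metis inj_on_eq_iff)
      ultimately show ?thesis
        using True tup[OF True] unfolding zs(1) \<phi>(2) tuples_def by auto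
    next
      case False
      then show ?thesis using zs(2) unfolding zs(1) \<phi>(2) tuples_def by auto
    qed
  qed
  show "ce_rel (rarity L r) (rel N r \<inter> tuples (rarity L r) (universe N))"
    if r: "r \<in> rsyms L" for r
  proof (rule ce_rel_cong)
    let ?k = "rarity L r"
    have "ce_rel ?k (rel M r \<inter> tuples ?k (universe M))" using M r unfolding ce_struct_def by blast
    from ce_rel_vimage[OF this \<phi>(1)]
    show "ce_rel ?k {xs. set xs \<subseteq> dom \<phi> \<and> map ?h xs \<in> rel M r \<inter> tuples ?k (universe M)}" .
    fix xs :: "nat list" assume "length xs = ?k"
    then have "set xs \<subseteq> dom \<phi> \<longleftrightarrow> xs \<in> tuples ?k (universe N)" unfolding \<phi>(2) tuples_def by simp
    then show "xs \<in> {xs. set xs \<subseteq> dom \<phi> \<and> map ?h xs \<in> rel M r \<inter> tuples ?k (universe M)} \<longleftrightarrow>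
        xs \<in> rel N r \<inter> tuples ?k (universe N)"
      using tup iso_via_rel[OF iso r] by blast
  qed
qed

text \<open>A computable enumeration of the universe without repetition renames its elements by all natural
  numbers.\<close>

lemma ce_struct_on_UNIV:
  assumes M: "ce_struct L M"
  obtains N where "ce_struct L N" "universe N = UNIV" "isomorphic L M N"
proof -
  have "ce_set (universe M)" "infinite (universe M)" and M': "is_struct L M"
    using M unfolding ce_struct_def by auto
  from this(1,2) obtain g where g: "computable_map g" "bij_betw g UNIV (universe M)"
    by (rule ce_set_enumeration)
  let ?N = "transport (inv g) g UNIV M"
  have iso: "iso_via L (inv g) M ?N"
    by (rule iso_via_transport)
      (use g(2) in \<open>auto intro: bij_betw_inv_into bij_betw_inv_into_right\<close>)
  have "iso_via L g ?N M"
    by (rule iso_via_inverse[OF M' iso]) (use g(2) in \<open>auto intro: bij_betw_inv_into_right\<close>)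
  then have "ce_struct L ?N"
    using computable_map_Some[OF g(1)] iso_via_is_struct[OF M' iso]
    by (intro ce_struct_pullback[OF M, of "\<lambda>x. Some (g x)"]) (auto simp: transport_def)
  moreover have "universe ?N = UNIV" by (simp add: transport_def)
  ultimately show thesis using that iso unfolding isomorphic_iff_iso_via by blast
qed

lemma computable_imp_ce_struct:
  assumes "computable_struct L M"
  shows "ce_struct L M"
  unfolding ce_struct_def
proof (intro conjI ballI)
  have U: "universe M = UNIV" using assms unfolding computable_struct_def by blast
  show "is_struct L M" using assms unfolding computable_struct_def by blast
  show "infinite (universe M)" using U by simp
  show "ce_set (universe M)"
    unfolding U by (rule ce_set_computable, rule computable_relI) (simp add: computable_const)
  show "ce_rel (Suc (farity L f)) {xs @ [func M f xs] | xs. xs \<in> tuples (farity L f) (universe M)}"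
    if f: "f \<in> fsyms L" for f
  proof (rule ce_rel_cong[OF computable_imp_ce_rel])
    let ?k = "farity L f"
    have "computable_fun ?k (func M f)" using assms f unfolding computable_struct_def by blast
    then have "computable_fun (Suc ?k) (\<lambda>zs. func M f (map (\<lambda>h. h zs) (map (\<lambda>i zs. zs ! i) [0..<?k])))"
      by (intro computable_fun_comp) (auto intro: computable_nth)
    from computable_eq[OF this computable_nth[of ?k]]
    show "computable_rel (Suc ?k)
        {zs. func M f (map (\<lambda>h. h zs) (map (\<lambda>i zs. zs ! i) [0..<?k])) = zs ! ?k}" by simp
    fix zs :: "nat list" assume "length zs = Suc ?k"
    then obtain xs y where zs: "zs = xs @ [y]" "length xs = ?k"
      by (metis length_Suc_conv_rev)
    have "map (\<lambda>h. h zs) (map (\<lambda>i zs. zs ! i) [0..<?k]) = xs"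
      unfolding zs by (auto intro!: nth_equalityI simp: zs(2) nth_append)
    then show "zs \<in> {zs. func M f (map (\<lambda>h. h zs) (map (\<lambda>i zs. zs ! i) [0..<?k])) = zs ! ?k} \<longleftrightarrow>
        zs \<in> {xs @ [func M f xs] | xs. xs \<in> tuples ?k (universe M)}"
      using zs(2) unfolding zs(1) U tuples_def by (auto simp: nth_append)
  qed
  show "ce_rel (rarity L r) (rel M r \<inter> tuples (rarity L r) (universe M))"
    if r: "r \<in> rsyms L" for r
    by (rule ce_rel_cong[OF computable_imp_ce_rel])
      (use assms r U in \<open>auto simp: computable_struct_def tuples_def\<close>)
qed

text \<open>In a linear ordering, whichever convention is used, the complement of the relation is its converse
  up to the diagonal. It is therefore c.e. together with the relation, and Post's theorem applies.\<close>

lemma ce_linear_ordering_computable: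
  assumes C: "ce_struct L C" "universe C = UNIV"
    and iso: "iso_via L h C B" and B: "substructure L B A" and A: "linear_ordering L A"
  shows "computable_struct L C"
proof -
  from A obtain r where f: "fsyms L = {}" and r: "rsyms L = {r}" and ar: "rarity L r = 2"
    and lin: "transp_on (universe A) (\<lambda>x y. [x, y] \<in> rel A r)"
      "totalp_on (universe A) (\<lambda>x y. [x, y] \<in> rel A r)"
      "irreflp_on (universe A) (\<lambda>x y. [x, y] \<in> rel A r) \<or>
       reflp_on (universe A) (\<lambda>x y. [x, y] \<in> rel A r) \<and>
       antisymp_on (universe A) (\<lambda>x y. [x, y] \<in> rel A r)"
    unfolding linear_ordering_def Let_def by blast
  have bij: "bij_betw h UNIV (universe B)" using iso_via_bij[OF iso] C(2) by simp
  then have inj: "h x = h y \<longleftrightarrow> x = y" and hB: "h x \<in> universe B" for x y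
    unfolding bij_betw_def by (auto simp: inj_eq)
  have hA: "h x \<in> universe A" for x using hB B unfolding substructure_def by blast
  have rel: "[x, y] \<in> rel C r \<longleftrightarrow> [h x, h y] \<in> rel A r" for x y
  proof -
    have "[x, y] \<in> rel C r \<longleftrightarrow> [h x, h y] \<in> rel B r"
      using iso_via_rel[OF iso, of r "[x, y]"] r ar C(2) by (simp add: tuples_def)
    also have "\<dots> \<longleftrightarrow> [h x, h y] \<in> rel A r"
      using B hB r ar unfolding substructure_def by (simp add: tuples_def)
    finally show ?thesis .
  qed
  have total: "[x, y] \<in> rel C r \<or> [y, x] \<in> rel C r" if "x \<noteq> y" for x y
    using lin(2) hA inj that unfolding rel totalp_on_def by blast
  have asym: "\<not> ([x, y] \<in> rel C r \<and> [y, x] \<in> rel C r)" if "x \<noteq> y" for x y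
    using lin(1,3) hA inj that unfolding rel transp_on_def irreflp_on_def antisymp_on_def by metis
  have diag: "(\<forall>x. [x, x] \<notin> rel C r) \<or> (\<forall>x. [x, x] \<in> rel C r)"
    using lin(3) hA unfolding rel irreflp_on_def reflp_on_def by blast
  have ce: "ce_rel 2 (rel C r)"
  proof (rule ce_rel_cong)
    show "ce_rel 2 (rel C r \<inter> tuples 2 UNIV)" using C r ar unfolding ce_struct_def by force
  qed (simp add: tuples_def)
  have eq: "computable_rel 2 {xs. xs ! 0 = xs ! 1}"
    by (intro computable_eq computable_nth) auto
  have pair: "\<exists>x y. xs = [x, y]" if "length xs = 2" for xs :: "nat list"
    using that by (auto simp: numeral_2_eq_2 length_Suc_conv)
  from diag have "computable_rel 2 (rel C r)"
  proof
    assume irr: "\<forall>x. [x, x] \<notin> rel C r"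
    show ?thesis
    proof (rule computable_relI_Post[OF ce])
      show "ce_rel 2 ({xs. [xs ! 1, xs ! 0] \<in> rel C r} \<union> {xs. xs ! 0 = xs ! 1})"
        by (intro ce_rel_Un ce_rel_converse ce computable_imp_ce_rel eq)
      fix xs :: "nat list" assume "length xs = 2"
      from pair[OF this] obtain x y where "xs = [x, y]" by blast
      then show "xs \<in> {xs. [xs ! 1, xs ! 0] \<in> rel C r} \<union> {xs. xs ! 0 = xs ! 1} \<longleftrightarrow> xs \<notin> rel C r"
        using irr total[of x y] asym[of x y] by auto
    qed
  next
    assume refl: "\<forall>x. [x, x] \<in> rel C r"
    show ?thesis
    proof (rule computable_relI_Post[OF ce])
      show "ce_rel 2 ({xs. [xs ! 1, xs ! 0] \<in> rel C r} \<inter> {xs. xs ! 0 \<noteq> xs ! 1})"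
        by (intro ce_rel_Int ce_rel_converse ce computable_imp_ce_rel computable_Not eq)
      fix xs :: "nat list" assume "length xs = 2"
      from pair[OF this] obtain x y where "xs = [x, y]" by blast
      then show "xs \<in> {xs. [xs ! 1, xs ! 0] \<in> rel C r} \<inter> {xs. xs ! 0 \<noteq> xs ! 1} \<longleftrightarrow> xs \<notin> rel C r"
        using refl total[of x y] asym[of x y] by auto
    qed
  qed
  then show ?thesis
    using C f r ar unfolding computable_struct_def ce_struct_def by simp
qed

section \<open>Generically computable and generically c.e. copies\<close>

text \<open>The operations of the dense substructure are conjugated by an enumeration \<open>g\<close> of its universe \<open>D\<close>.
  The partial computable functions that represent them are only applied to values of \<open>g\<close>, and so only
  to tuples from \<open>D\<close>, where they are defined and correct.\<close>

lemma generically_computable_substructure: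
  assumes M: "is_struct L M" "isomorphic L M A" and gen: "generically_computable L M"
  obtains B C where "substructure L B A" "infinite (universe B)" "computable_struct L C"
    "isomorphic L B C"
proof -
  from gen obtain B where B: "substructure L B M" "dense (universe B)" "ce_set (universe B)"
    and func: "\<forall>f\<in>fsyms L. \<exists>p. partial_computable (farity L f) p \<and>
        (\<forall>xs\<in>tuples (farity L f) (universe B). p xs = Some (func M f xs))"
    and rel: "\<forall>r\<in>rsyms L. \<exists>p. partial_computable (rarity L r) p \<and>
        (\<forall>xs\<in>tuples (rarity L r) (universe B). p xs = Some (char_fun (rel M r) xs))"
    unfolding generically_computable_def by (elim exE conjE) (rule that)
  have B': "is_struct L B" by (rule substructure_is_struct[OF B(1)])
  have inf: "infinite (universe B)" by (rule dense_infinite[OF B(2)])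
  obtain g where g: "computable_map g" "bij_betw g UNIV (universe B)"
    using ce_set_enumeration[OF B(3) inf] by blast
  have inj: "inj g" and ran: "range g = universe B" using g(2) by (auto simp: bij_betw_def)
  obtain \<phi> where \<phi>: "partial_computable_map \<phi>" "dom \<phi> = range g" "\<And>n. \<phi> (g n) = Some n"
    using partial_computable_inverse[OF g(1) inj] by blast
  let ?h = "\<lambda>x. the (\<phi> x)"
  let ?C = "transport ?h g UNIV B"
  have gh: "g (?h x) = x" if "x \<in> universe B" for x using that \<phi>(3) by (auto simp flip: ran)
  have "bij_betw ?h (universe B) UNIV"
    by (rule bij_betw_byWitness[of _ g]) (use gh \<phi>(3) ran in auto)
  then have iso: "iso_via L ?h B ?C" using gh by (rule iso_via_transport)
  have C: "computable_struct L ?C"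
    unfolding computable_struct_def
  proof (intro conjI ballI)
    show "is_struct L ?C" by (rule iso_via_is_struct[OF B' iso])
    show "universe ?C = UNIV" by (simp add: transport_def)
    have tup: "map g xs \<in> tuples k (universe B)" if "length xs = k" for xs k
      using that ran unfolding tuples_def by auto
    have dom: "dom (\<lambda>x. Some (g x)) = UNIV" by auto
    note pullback = partial_computable_map_tuple[OF _ computable_map_Some[OF g(1)],
        unfolded dom, simplified]
    show "computable_fun (farity L f) (func ?C f)" if f: "f \<in> fsyms L" for f
    proof -
      from bspec[OF func f] obtain p where p: "partial_computable (farity L f) p"
        "\<And>xs. xs \<in> tuples (farity L f) (universe B) \<Longrightarrow> p xs = Some (func M f xs)" by blast
      from partial_computable_bind[OF pullback[OF p(1)] \<phi>(1)] show ?thesis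
        unfolding computable_fun_def
      proof (rule partial_computable_cong)
        fix xs :: "nat list" assume "length xs = farity L f"
        note xs = tup[OF this]
        have "func M f (map g xs) = func B f (map g xs)"
          using B(1) f xs unfolding substructure_def by simp
        moreover have "func B f (map g xs) \<in> dom \<phi>"
          using is_struct_func[OF B' f xs] unfolding \<phi>(2) ran .
        ultimately show "Option.bind (p (map g xs)) \<phi> = Some (func ?C f xs)"
          by (auto simp: p(2)[OF xs] transport_def)
      qed
    qed
    show "computable_rel (rarity L r) (rel ?C r)" if r: "r \<in> rsyms L" for r
    proof -
      from bspec[OF rel r] obtain p where p: "partial_computable (rarity L r) p"
        "\<And>xs. xs \<in> tuples (rarity L r) (universe B) \<Longrightarrow> p xs = Some (char_fun (rel M r) xs)" by blast
      from pullback[OF p(1)] show ?thesis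
        unfolding computable_rel_def computable_fun_def
      proof (rule partial_computable_cong)
        fix xs :: "nat list" assume "length xs = rarity L r"
        note xs = tup[OF this]
        have "map g xs \<in> rel M r \<longleftrightarrow> map g xs \<in> rel B r"
          using B(1) r xs unfolding substructure_def by simp
        then show "p (map g xs) = Some (char_fun (rel ?C r) xs)"
          by (simp add: p(2)[OF xs] transport_def char_fun_def)
      qed
    qed
  qed
  from M(2) obtain k where k: "iso_via L k M A" unfolding isomorphic_iff_iso_via by blast
  let ?B = "A\<lparr>universe := k ` universe B\<rparr>"
  note img = substructure_image[OF k B(1)]
  have "infinite (universe ?B)"
    using inf bij_betw_finite[OF iso_via_bij[OF img(2)]] by simp
  moreover have "isomorphic L ?B ?C"
    using isomorphic_trans[OF isomorphic_sym[OF B']] iso img(2)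
    unfolding isomorphic_iff_iso_via by blast
  ultimately show thesis using that[OF img(1) _ C] by blast
qed

text \<open>The copy for both converse directions: \<open>B\<close> is moved onto a dense set in such a way that the given
  isomorphism with \<open>C\<close> turns into a computable enumeration of that set, through which effectiveness is
  inherited from \<open>C\<close>.\<close>

lemma copy_with_dense_substructure:
  assumes A: "is_struct L A" "universe A = UNIV" and B: "substructure L B A"
    and C: "universe C = UNIV" and iso: "isomorphic L B C"
  obtains M N \<tau> g \<phi> where "copy_of L M A" "iso_via L \<tau> A M" "N = M\<lparr>universe := \<tau> ` universe B\<rparr>"
    "substructure L N M" "dense (universe N)" "ce_set (universe N)"
    "computable_map g" "iso_via L g C N"
    "partial_computable_map \<phi>" "dom \<phi> = universe N" "\<And>n. \<phi> (g n) = Some n"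
proof -
  have B': "is_struct L B" by (rule substructure_is_struct[OF B])
  obtain \<kappa> where \<kappa>: "iso_via L \<kappa> C B"
    using isomorphic_sym[OF B' iso] unfolding isomorphic_iff_iso_via by blast
  then have "bij_betw \<kappa> UNIV (universe B)" using iso_via_bij C by metis
  then obtain \<tau> g where \<tau>: "bij \<tau>" and g: "computable_map g" "bij_betw g UNIV (\<tau> ` universe B)"
    and dense: "dense (\<tau> ` universe B)" and comp: "\<tau> \<circ> \<kappa> = g" by (rule move_to_dense_set)
  have inj: "inj g" and ran: "range g = \<tau> ` universe B" using g(2) by (auto simp: bij_betw_def)
  obtain \<phi> where \<phi>: "partial_computable_map \<phi>" "dom \<phi> = range g" "\<And>n. \<phi> (g n) = Some n"
    using partial_computable_inverse[OF g(1) inj] by blast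
  let ?M = "transport \<tau> (inv \<tau>) UNIV A"
  let ?N = "?M\<lparr>universe := \<tau> ` universe B\<rparr>"
  have M: "iso_via L \<tau> A ?M"
    by (rule iso_via_transport) (use \<tau> A(2) in \<open>auto simp: bij_is_inj\<close>)
  have "copy_of L ?M A"
    unfolding copy_of_def using iso_via_is_struct[OF A(1) M] isomorphic_sym[OF A(1)] M
    by (auto simp: isomorphic_iff_iso_via transport_def)
  note img = substructure_image[OF M B]
  have "iso_via L g C ?N" using iso_via_trans[OF \<kappa> img(2)] unfolding comp .
  moreover have "ce_set (universe ?N)" using ce_set_dom[OF \<phi>(1)] \<phi>(2) ran by simp
  moreover have "dom \<phi> = universe ?N" using \<phi>(2) ran by simp
  ultimately show thesis
    using that[OF \<open>copy_of L ?M A\<close> M refl img(1) _ _ g(1) _ \<phi>(1) _ \<phi>(3)] dense by simp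
qed

lemma generically_computable_copy:
  assumes A: "is_struct L A" "universe A = UNIV" and B: "substructure L B A"
    and C: "computable_struct L C" and iso: "isomorphic L B C"
  obtains M where "copy_of L M A" "generically_computable L M"
proof -
  have CU: "universe C = UNIV" using C unfolding computable_struct_def by blast
  obtain M N \<tau> g \<phi> where M: "copy_of L M A" and N: "substructure L N M" "dense (universe N)"
    "ce_set (universe N)" and g: "computable_map g" "iso_via L g C N"
    and \<phi>: "partial_computable_map \<phi>" "dom \<phi> = universe N" "\<And>n. \<phi> (g n) = Some n"
    by (rule copy_with_dense_substructure[OF A B CU iso]) blast
  have ran: "universe N = g ` UNIV" using iso_via_bij[OF g(2)] CU by (simp add: bij_betw_def)
  have preimage: "\<exists>ns\<in>tuples k (universe C).
      xs = map g ns \<and> set xs \<subseteq> dom \<phi> \<and> map (\<lambda>x. the (\<phi> x)) xs = ns"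
    if xs: "xs \<in> tuples k (universe N)" for xs k
  proof -
    from xs obtain ns where ns: "ns \<in> tuples k UNIV" "xs = map g ns"
      unfolding ran by (rule tuples_imageE)
    moreover have "map (\<lambda>x. the (\<phi> x)) xs = ns" unfolding ns(2) by (simp add: \<phi>(3) comp_def)
    moreover have "set xs \<subseteq> dom \<phi>" using xs \<phi>(2) unfolding tuples_def by simp
    ultimately show ?thesis unfolding CU by blast
  qed
  have "\<exists>p. partial_computable (farity L f) p \<and>
      (\<forall>xs\<in>tuples (farity L f) (universe N). p xs = Some (func M f xs))" if f: "f \<in> fsyms L" for f
  proof -
    let ?k = "farity L f"
    have "partial_computable ?k (\<lambda>xs. Some (func C f xs))"
      using C f unfolding computable_struct_def computable_fun_def by blast
    note p = partial_computable_bind[OF partial_computable_map_tuple[OF this \<phi>(1)]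
        computable_map_Some[OF g(1)]]
    show ?thesis
    proof (rule exI, rule conjI[OF p], rule ballI)
      fix xs assume xs: "xs \<in> tuples ?k (universe N)"
      from preimage[OF xs] obtain ns where ns: "ns \<in> tuples ?k (universe C)" "xs = map g ns"
        "set xs \<subseteq> dom \<phi>" "map (\<lambda>x. the (\<phi> x)) xs = ns" by blast
      have "func M f xs = func N f xs" using N(1) f xs unfolding substructure_def by simp
      also have "\<dots> = g (func C f ns)" using iso_via_func[OF g(2) f ns(1)] ns(2) by simp
      finally show "Option.bind
          (if set xs \<subseteq> dom \<phi> then Some (func C f (map (\<lambda>x. the (\<phi> x)) xs)) else None)
          (\<lambda>x. Some (g x)) = Some (func M f xs)" using ns(3,4) by simp
    qed
  qed
  moreover have "\<exists>p. partial_computable (rarity L r) p \<and>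
      (\<forall>xs\<in>tuples (rarity L r) (universe N). p xs = Some (char_fun (rel M r) xs))"
    if r: "r \<in> rsyms L" for r
  proof -
    let ?k = "rarity L r"
    have "partial_computable ?k (\<lambda>xs. Some (char_fun (rel C r) xs))"
      using C r unfolding computable_struct_def computable_rel_def computable_fun_def by blast
    note p = partial_computable_map_tuple[OF this \<phi>(1)]
    show ?thesis
    proof (rule exI, rule conjI[OF p], rule ballI)
      fix xs assume xs: "xs \<in> tuples ?k (universe N)"
      from preimage[OF xs] obtain ns where ns: "ns \<in> tuples ?k (universe C)" "xs = map g ns"
        "set xs \<subseteq> dom \<phi>" "map (\<lambda>x. the (\<phi> x)) xs = ns" by blast
      have "xs \<in> rel M r \<longleftrightarrow> xs \<in> rel N r" using N(1) r xs unfolding substructure_def by simp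
      also have "\<dots> \<longleftrightarrow> ns \<in> rel C r" using iso_via_rel[OF g(2) r ns(1)] ns(2) by simp
      finally show "(if set xs \<subseteq> dom \<phi>
          then Some (char_fun (rel C r) (map (\<lambda>x. the (\<phi> x)) xs)) else None) =
          Some (char_fun (rel M r) xs)" using ns(3,4) by (simp add: char_fun_def)
    qed
  qed
  ultimately have "generically_computable L M"
    unfolding generically_computable_def using N by blast
  with M show thesis by (rule that)
qed

lemma Sigma_generically_ce_substructure:
  assumes M: "is_struct L M" "isomorphic L M A" and gen: "Sigma_generically_ce n L M"
  obtains B C where "Sigma_elementary_substructure n L B A" "infinite (universe B)"
    "ce_struct L C" "isomorphic L B C"
proof -
  from gen obtain C where C: "ce_struct L C" "Sigma_elementary_substructure n L C M"
    unfolding Sigma_generically_ce_def by blast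
  then have sub: "substructure L C M" and C': "is_struct L C" "infinite (universe C)"
    unfolding Sigma_elementary_substructure_def ce_struct_def by auto
  from M(2) obtain k where k: "iso_via L k M A" unfolding isomorphic_iff_iso_via by blast
  let ?B = "A\<lparr>universe := k ` universe C\<rparr>"
  have iso: "iso_via L k C ?B" by (rule substructure_image(2)[OF k sub])
  then have "isomorphic L C ?B" unfolding isomorphic_iff_iso_via by blast
  then have "isomorphic L ?B C" by (rule isomorphic_sym[OF C'(1)])
  moreover have "infinite (universe ?B)" using C'(2) bij_betw_finite[OF iso_via_bij[OF iso]] by simp
  ultimately show thesis
    using that[OF Sigma_elementary_substructure_image[OF M(1) k C(2)] _ C(1)] by blast
qed

lemma Sigma_generically_ce_copy:
  assumes A: "is_struct L A" "universe A = UNIV" and B: "Sigma_elementary_substructure n L B A"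
    and C: "ce_struct L C" and iso: "isomorphic L B C"
  obtains M where "copy_of L M A" "Sigma_generically_ce n L M"
proof -
  have sub: "substructure L B A" using B unfolding Sigma_elementary_substructure_def by blast
  obtain C' where C': "ce_struct L C'" "universe C' = UNIV" and "isomorphic L C C'"
    by (rule ce_struct_on_UNIV[OF C])
  then have iso': "isomorphic L B C'" using iso isomorphic_trans by blast
  obtain M N \<tau> g \<phi> where M: "copy_of L M A" "iso_via L \<tau> A M"
    and N: "N = M\<lparr>universe := \<tau> ` universe B\<rparr>" "substructure L N M" "dense (universe N)"
      "ce_set (universe N)"
    and g: "iso_via L g C' N"
    and \<phi>: "partial_computable_map \<phi>" "dom \<phi> = universe N" "\<And>n. \<phi> (g n) = Some n"
    by (rule copy_with_dense_substructure[OF A sub C'(2) iso']) blast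
  have "is_struct L C'" using C'(1) unfolding ce_struct_def by blast
  then have "iso_via L (\<lambda>x. the (\<phi> x)) N C'" using g by (rule iso_via_inverse) (simp add: \<phi>(3))
  then have "ce_struct L N"
    by (rule ce_struct_pullback[OF C'(1) \<phi>(1,2) _ substructure_is_struct[OF N(2)]
          dense_infinite[OF N(3)]])
  moreover have "Sigma_elementary_substructure n L N M"
    unfolding N(1) by (rule Sigma_elementary_substructure_image[OF A(1) M(2) B])
  ultimately have "Sigma_generically_ce n L M"
    unfolding Sigma_generically_ce_def using N by blast
  with M(1) show thesis by (rule that)
qed

text \<open>For the linear orderings, only the passage from a c.e. to a computable structure is left: the
  second part has already provided the substructure.\<close>

theorem proposition3p2:
  fixes L :: "('f, 'r) language" and A :: "('f, 'r) struct" and n :: nat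
  assumes "is_struct L A" and "universe A = UNIV"
  shows "((\<exists>M. copy_of L M A \<and> generically_computable L M) \<longleftrightarrow>
           (\<exists>B C. substructure L B A \<and> infinite (universe B) \<and>
              computable_struct L C \<and> isomorphic L B C)) \<and>
         ((\<exists>M. copy_of L M A \<and> Sigma_generically_ce n L M) \<longleftrightarrow>
           (\<exists>B C. Sigma_elementary_substructure n L B A \<and> infinite (universe B) \<and>
              ce_struct L C \<and> isomorphic L B C)) \<and>
         (linear_ordering L A \<longrightarrow>
           ((\<exists>M. copy_of L M A \<and> Sigma_generically_ce n L M) \<longleftrightarrow>
             (\<exists>B C. Sigma_elementary_substructure n L B A \<and> infinite (universe B) \<and>
                computable_struct L C \<and> isomorphic L B C)))"
proof (intro conjI impI)
  show "(\<exists>M. copy_of L M A \<and> generically_computable L M) \<longleftrightarrow>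
      (\<exists>B C. substructure L B A \<and> infinite (universe B) \<and>
        computable_struct L C \<and> isomorphic L B C)"
    using generically_computable_substructure generically_computable_copy[OF assms]
    unfolding copy_of_def by metis
  show ce: "(\<exists>M. copy_of L M A \<and> Sigma_generically_ce n L M) \<longleftrightarrow>
      (\<exists>B C. Sigma_elementary_substructure n L B A \<and> infinite (universe B) \<and>
        ce_struct L C \<and> isomorphic L B C)"
    using Sigma_generically_ce_substructure Sigma_generically_ce_copy[OF assms]
    unfolding copy_of_def by metis
  assume lin: "linear_ordering L A"
  have "\<exists>D. computable_struct L D \<and> isomorphic L B D"
    if B: "Sigma_elementary_substructure n L B A" and C: "ce_struct L C" "isomorphic L B C" for B C
  proof -
    have sub: "substructure L B A" using B unfolding Sigma_elementary_substructure_def by blast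
    obtain D where D: "ce_struct L D" "universe D = UNIV" "isomorphic L C D"
      by (rule ce_struct_on_UNIV[OF C(1)])
    have BD: "isomorphic L B D" by (rule isomorphic_trans[OF C(2) D(3)])
    obtain h where "iso_via L h D B"
      using isomorphic_sym[OF substructure_is_struct[OF sub] BD]
      unfolding isomorphic_iff_iso_via by blast
    with BD show ?thesis using ce_linear_ordering_computable[OF D(1,2) _ sub lin] by blast
  qed
  then show "(\<exists>M. copy_of L M A \<and> Sigma_generically_ce n L M) \<longleftrightarrow>
      (\<exists>B C. Sigma_elementary_substructure n L B A \<and> infinite (universe B) \<and>
        computable_struct L C \<and> isomorphic L B C)"
    unfolding ce using computable_imp_ce_struct by blast
qed

end
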